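(* Let $R$ be an integer with $|R|\ge 2$. For $a\in\mathbb{R}\setminus\{0\}$ let $B=\{0,a\}$ and let $\mu$ be the unique probability measure on $\mathbb{R}$ satisfying $\mu=\frac12\sum_{b\in B}\mu\circ\sigma_b^{-1}$, where $\sigma_b(x):=R^{-1}x+b$. If $R$ is odd, then $L^2(\mu)$ does not have an orthogonal basis of exponentials for any $a\in\mathbb{R}\setminus\{0\}$. If $R$ is even and $|R|\ge 4$, then $L^2(\mu)$ has an orthogonal basis of exponentials for all $a\in\mathbb{R}\setminus\{0\}$.
   Context: An orthogonal basis of exponentials for $L^2(\mu)$ is an orthogonal basis of the form $\{e_\lambda:\lambda\in\Lambda\}$ for some set $\Lambda\subset\mathbb{R}$, where $e_\lambda(x):=e^{i2\pi\lambda x}$. *)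

theory Defs
  imports "HOL-Probability.Probability"
begin

definition sigma_map :: "int \<Rightarrow> real \<Rightarrow> real \<Rightarrow> real" where
  "sigma_map R b x = inverse (of_int R) * x + b"

definition invariant_prob_measure :: "int \<Rightarrow> real \<Rightarrow> real measure \<Rightarrow> bool" where
  "invariant_prob_measure R a \<mu> \<longleftrightarrow>
     prob_space \<mu> \<and> sets \<mu> = sets borel \<and>
     (\<forall>A\<in>sets borel.
        measure \<mu> A = 1 / 2 * (\<Sum>b\<in>{0, a}. measure (distr \<mu> borel (sigma_map R b)) A))"

text \<open>Elements of the Hilbert space are represented by functions rather than by classes modulo
  almost-everywhere equality; all notions below depend only on the class.\<close>

definition L2_space :: "'a measure \<Rightarrow> ('a \<Rightarrow> complex) set" where
  "L2_space M = {f \<in> borel_measurable M. integrable M (\<lambda>x. (cmod (f x))\<^sup>2)}"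

definition L2_inner :: "'a measure \<Rightarrow> ('a \<Rightarrow> complex) \<Rightarrow> ('a \<Rightarrow> complex) \<Rightarrow> complex" where
  "L2_inner M f g = (LINT x|M. f x * cnj (g x))"

definition L2_norm :: "'a measure \<Rightarrow> ('a \<Rightarrow> complex) \<Rightarrow> real" where
  "L2_norm M f = sqrt (LINT x|M. (cmod (f x))\<^sup>2)"

text \<open>An orthogonal basis: nonzero, pairwise orthogonal vectors with dense complex linear span.\<close>

definition L2_orthogonal_basis :: "'a measure \<Rightarrow> ('a \<Rightarrow> complex) set \<Rightarrow> bool" where
  "L2_orthogonal_basis M S \<longleftrightarrow>
     S \<subseteq> L2_space M \<and>
     (\<forall>g\<in>S. L2_norm M g \<noteq> 0) \<and>
     (\<forall>g\<in>S. \<forall>h\<in>S. g \<noteq> h \<longrightarrow> L2_inner M g h = 0) \<and>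
     (\<forall>f\<in>L2_space M. \<forall>\<epsilon>>0. \<exists>F c. finite F \<and> F \<subseteq> S \<and>
        L2_norm M (\<lambda>x. f x - (\<Sum>g\<in>F. c g * g x)) < \<epsilon>)"

definition e_fun :: "real \<Rightarrow> real \<Rightarrow> complex" where
  "e_fun l x = exp (\<i> * complex_of_real (2 * pi * l * x))"

definition has_orthogonal_basis_of_exponentials :: "real measure \<Rightarrow> bool" where
  "has_orthogonal_basis_of_exponentials \<mu> \<longleftrightarrow>
     (\<exists>\<Lambda> :: real set. L2_orthogonal_basis \<mu> (e_fun ` \<Lambda>))"

end

theory Submission
  imports Defs "HOL-Real_Asymp.Real_Asymp"
begin

text \<open>
  Let \<open>F t = (LINT x|\<mu>. e_fun t x)\<close>. Exponentials of frequencies \<open>s\<close> and \<open>t\<close> have the inner product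
  \<open>F (s - t)\<close>, so everything is decided by the zeros and the size of \<open>F\<close>. Integrating \<open>e_fun t\<close> against the
  invariance equation gives \<open>\<bar>F t\<bar>\<^sup>2 = (cos (pi * a * t))\<^sup>2 * \<bar>F (t / R)\<bar>\<^sup>2\<close>, hence an infinite product of cosines,
  and \<open>F t = 0\<close> holds iff \<open>t\<close> is an odd integer times \<open>R ^ k / (2 * a)\<close> for some \<open>k\<close>. Below frequencies are
  measured in the unit \<open>1 / (2 * a)\<close>, and \<open>G u = \<bar>F (u / (2 * a))\<bar>\<^sup>2\<close>.

  If \<open>R\<close> is odd, all zeros of \<open>G\<close> are odd integers. Among three numbers some difference is the sum of two
  others, so the three differences cannot all be odd, and at most two exponentials are mutually orthogonal.
  Two frequencies \<open>u0\<close> and \<open>u0 + j\<close>, with \<open>j\<close> odd, do not suffice for a basis: the exponential of frequency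
  \<open>u0 + j + 2\<close> is orthogonal to the first, and its coefficient at the second has the square \<open>G 2 < 1\<close>
  (lemma \<open>no_orthogonal_basis_of_exponentials\<close>).

  If \<open>R\<close> is even and \<open>\<bar>R\<bar> \<ge> 4\<close>, take as frequencies all sums \<open>\<Sum>k<n. l k * R ^ k\<close> with digits 0 and 1. Differences
  of two distinct ones are \<open>R ^ k\<close> times an odd integer, so the exponentials are orthogonal
  (\<open>G_digit_sums_diff\<close>). For completeness, consider the squared norm \<open>Q x\<close> of the projection of the exponential
  of frequency \<open>x\<close> to their closed span. Splitting off the lowest digit yields
  \<open>Q x = (cos (pi * x / 2))\<^sup>2 * Q (x / R) + (sin (pi * x / 2))\<^sup>2 * Q ((x - 1) / R)\<close>,
  so \<open>Q\<close> is a fixed point of an averaging operator. For \<open>\<bar>R\<bar> \<ge> 4\<close> a minimum principle on the interval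
  \<open>{-1/2..1/2}\<close> forces \<open>Q = 1\<close> there (\<open>spectral_sum_lim_near_0\<close>), and the contractions carry this to the whole
  line. So every exponential lies in the closed span. Finally, exponentials are
  dense in \<open>L\<^sup>2\<close> of any finite Borel measure on the line (\<open>L2_closure_eq_L2_space\<close>).
\<close>

section \<open>Square-integrable functions and closed spans\<close>

lemma cmod_add_sq_le: "(cmod (z + w))\<^sup>2 \<le> 2 * (cmod z)\<^sup>2 + 2 * (cmod w)\<^sup>2"
proof -
  have "(cmod (z + w))\<^sup>2 \<le> (cmod z + cmod w)\<^sup>2"
    by (intro power_mono norm_triangle_ineq) auto
  also have "\<dots> \<le> 2 * (cmod z)\<^sup>2 + 2 * (cmod w)\<^sup>2"
    using sum_squares_bound[of "cmod z" "cmod w"] by (simp add: power2_sum)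
  finally show ?thesis .
qed

lemma L2_measurable: "f \<in> L2_space M \<Longrightarrow> f \<in> borel_measurable M"
  and L2_square_integrable: "f \<in> L2_space M \<Longrightarrow> integrable M (\<lambda>x. (cmod (f x))\<^sup>2)"
  by (auto simp: L2_space_def)

lemma L2_zero [simp]: "(\<lambda>x. 0) \<in> L2_space M"
  by (simp add: L2_space_def)

lemma L2_add:
  assumes "f \<in> L2_space M" "g \<in> L2_space M"
  shows "(\<lambda>x. f x + g x) \<in> L2_space M"
proof -
  note [measurable] = assms[THEN L2_measurable]
  have "integrable M (\<lambda>x. 2 * (cmod (f x))\<^sup>2 + 2 * (cmod (g x))\<^sup>2)"
    using assms by (auto simp: L2_space_def)
  then have "integrable M (\<lambda>x. (cmod (f x + g x))\<^sup>2)"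
    by (rule Bochner_Integration.integrable_bound) (auto simp: cmod_add_sq_le)
  then show ?thesis by (simp add: L2_space_def)
qed

lemma L2_scale:
  assumes "f \<in> L2_space M"
  shows "(\<lambda>x. c * f x) \<in> L2_space M"
  using assms by (auto simp: L2_space_def norm_mult power_mult_distrib)

lemma L2_diff:
  assumes "f \<in> L2_space M" "g \<in> L2_space M"
  shows "(\<lambda>x. f x - g x) \<in> L2_space M"
  using L2_add[OF assms(1) L2_scale[OF assms(2), of "-1"]] by simp

lemma L2_sum:
  assumes "\<And>i. i \<in> I \<Longrightarrow> f i \<in> L2_space M"
  shows "(\<lambda>x. \<Sum>i\<in>I. f i x) \<in> L2_space M"
  using assms by (induction I rule: infinite_finite_induct) (auto intro: L2_add)

lemma L2_combination:
  assumes "F \<subseteq> S" "S \<subseteq> L2_space M"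
  shows "(\<lambda>x. \<Sum>g\<in>F. c g * g x) \<in> L2_space M"
  using assms by (intro L2_sum L2_scale) auto

lemma L2_dist_triangle:
  assumes "f \<in> L2_space M" "g \<in> L2_space M" "h \<in> L2_space M"
  shows "(LINT x|M. (cmod (f x - h x))\<^sup>2) \<le>
    2 * (LINT x|M. (cmod (f x - g x))\<^sup>2) + 2 * (LINT x|M. (cmod (g x - h x))\<^sup>2)"
proof -
  note [simp] = L2_square_integrable[OF L2_diff]
  have "(LINT x|M. (cmod (f x - h x))\<^sup>2) \<le>
    (LINT x|M. 2 * (cmod (f x - g x))\<^sup>2 + 2 * (cmod (g x - h x))\<^sup>2)"
  proof (intro integral_mono)
    fix x
    show "(cmod (f x - h x))\<^sup>2 \<le> 2 * (cmod (f x - g x))\<^sup>2 + 2 * (cmod (g x - h x))\<^sup>2"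
      using cmod_add_sq_le[of "f x - g x" "g x - h x"] by simp
  qed (use assms in auto)
  then show ?thesis using assms by simp
qed

lemma L2_bounded:
  assumes "finite_measure M" "f \<in> borel_measurable M" "\<And>x. x \<in> space M \<Longrightarrow> cmod (f x) \<le> B"
  shows "f \<in> L2_space M"
proof -
  have "integrable M (\<lambda>x. (cmod (f x))\<^sup>2)"
    using assms by (intro finite_measure.integrable_const_bound[where B = "B\<^sup>2"])
      (auto intro!: AE_I2 power_mono)
  with assms show ?thesis by (simp add: L2_space_def)
qed

text \<open>Measuring the error by the integral of its square, without the root, lets all estimates use
  \<open>cmod (z + w)\<^sup>2 \<le> 2 * (cmod z)\<^sup>2 + 2 * (cmod w)\<^sup>2\<close> where one would otherwise need the triangle inequality
  for the norm.\<close>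

definition L2_closure :: "'a measure \<Rightarrow> ('a \<Rightarrow> complex) set \<Rightarrow> ('a \<Rightarrow> complex) set" where
  "L2_closure M S = {f \<in> L2_space M. \<forall>\<epsilon>>0. \<exists>F c. finite F \<and> F \<subseteq> S \<and>
     (LINT x|M. (cmod (f x - (\<Sum>g\<in>F. c g * g x)))\<^sup>2) < \<epsilon>}"

lemma L2_closureI:
  assumes "f \<in> L2_space M"
    and "\<And>\<epsilon>. \<epsilon> > 0 \<Longrightarrow> \<exists>F c. finite F \<and> F \<subseteq> S \<and>
      (LINT x|M. (cmod (f x - (\<Sum>g\<in>F. c g * g x)))\<^sup>2) < \<epsilon>"
  shows "f \<in> L2_closure M S"
  using assms by (auto simp: L2_closure_def)

lemma L2_closureE:
  assumes "f \<in> L2_closure M S" "\<epsilon> > 0"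
  obtains F c where "finite F" "F \<subseteq> S" "(LINT x|M. (cmod (f x - (\<Sum>g\<in>F. c g * g x)))\<^sup>2) < \<epsilon>"
  using assms unfolding L2_closure_def by blast

lemma L2_closure_L2: "f \<in> L2_closure M S \<Longrightarrow> f \<in> L2_space M"
  by (simp add: L2_closure_def)

lemma L2_closure_add:
  assumes S: "S \<subseteq> L2_space M" and f: "f \<in> L2_closure M S" and g: "g \<in> L2_closure M S"
  shows "(\<lambda>x. f x + g x) \<in> L2_closure M S"
proof (rule L2_closureI)
  show "(\<lambda>x. f x + g x) \<in> L2_space M"
    using f g by (intro L2_add L2_closure_L2)
  fix \<epsilon> :: real assume "\<epsilon> > 0"
  then have e: "\<epsilon>/4 > 0" by simp
  obtain F c where F: "finite F" "F \<subseteq> S" "(LINT x|M. (cmod (f x - (\<Sum>g\<in>F. c g * g x)))\<^sup>2) < \<epsilon>/4"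
    using L2_closureE[OF f e] .
  obtain G d where G: "finite G" "G \<subseteq> S" "(LINT x|M. (cmod (g x - (\<Sum>g\<in>G. d g * g x)))\<^sup>2) < \<epsilon>/4"
    using L2_closureE[OF g e] .
  define k where "k = (\<lambda>h. (if h \<in> F then c h else 0) + (if h \<in> G then d h else 0))"
  have split: "(\<Sum>h\<in>F\<union>G. k h * h x) = (\<Sum>h\<in>F. c h * h x) + (\<Sum>h\<in>G. d h * h x)" for x
  proof -
    have "(\<Sum>h\<in>F\<union>G. k h * h x) = (\<Sum>h\<in>F\<union>G. if h \<in> F then c h * h x else 0) +
        (\<Sum>h\<in>F\<union>G. if h \<in> G then d h * h x else 0)"
      unfolding sum.distrib[symmetric] k_def by (intro sum.cong) (auto simp: algebra_simps)
    also have "(\<Sum>h\<in>F\<union>G. if h \<in> F then c h * h x else 0) = (\<Sum>h\<in>F. c h * h x)"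
      using F G by (intro sum.mono_neutral_cong_right) auto
    also have "(\<Sum>h\<in>F\<union>G. if h \<in> G then d h * h x else 0) = (\<Sum>h\<in>G. d h * h x)"
      using F G by (intro sum.mono_neutral_cong_right) auto
    finally show ?thesis .
  qed
  note [simp] = L2_square_integrable[OF L2_diff[OF L2_closure_L2[OF f] L2_combination[OF F(2) S]]]
    L2_square_integrable[OF L2_diff[OF L2_closure_L2[OF g] L2_combination[OF G(2) S]]]
  let ?u = "\<lambda>x. f x - (\<Sum>h\<in>F. c h * h x)" and ?v = "\<lambda>x. g x - (\<Sum>h\<in>G. d h * h x)"
  note u = L2_diff[OF L2_closure_L2[OF f] L2_combination[OF F(2) S, of c]]
  note v = L2_diff[OF L2_closure_L2[OF g] L2_combination[OF G(2) S, of d]]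
  have "(LINT x|M. (cmod (?u x + ?v x))\<^sup>2) \<le> (LINT x|M. 2 * (cmod (?u x))\<^sup>2 + 2 * (cmod (?v x))\<^sup>2)"
    by (intro integral_mono L2_square_integrable[OF L2_add[OF u v]] cmod_add_sq_le) auto
  also have "\<dots> < \<epsilon>" using F(3) G(3) by simp
  finally have "(LINT x|M. (cmod (f x + g x - (\<Sum>h\<in>F\<union>G. k h * h x)))\<^sup>2) < \<epsilon>"
    unfolding split by (simp add: algebra_simps)
  then show "\<exists>F c. finite F \<and> F \<subseteq> S \<and> (LINT x|M. (cmod (f x + g x - (\<Sum>g\<in>F. c g * g x)))\<^sup>2) < \<epsilon>"
    using F G by (intro exI[of _ "F \<union> G"] exI[of _ k]) auto
qed

lemma L2_closure_scale:
  assumes f: "f \<in> L2_closure M S"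
  shows "(\<lambda>x. k * f x) \<in> L2_closure M S"
proof (rule L2_closureI)
  show "(\<lambda>x. k * f x) \<in> L2_space M"
    using f by (intro L2_scale L2_closure_L2)
  fix \<epsilon> :: real assume "\<epsilon> > 0"
  have pos: "(cmod k)\<^sup>2 + 1 > 0" by (simp add: add_nonneg_pos)
  obtain F c where F: "finite F" "F \<subseteq> S"
      and lt: "(LINT x|M. (cmod (f x - (\<Sum>g\<in>F. c g * g x)))\<^sup>2) < \<epsilon> / ((cmod k)\<^sup>2 + 1)" (is "?I < _")
    using L2_closureE[OF f, of "\<epsilon> / ((cmod k)\<^sup>2 + 1)"] \<open>\<epsilon> > 0\<close> pos by auto
  have "k * f x - (\<Sum>g\<in>F. k * c g * g x) = k * (f x - (\<Sum>g\<in>F. c g * g x))" for x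
    by (simp add: right_diff_distrib sum_distrib_left mult.assoc)
  then have "(LINT x|M. (cmod (k * f x - (\<Sum>g\<in>F. k * c g * g x)))\<^sup>2) = (cmod k)\<^sup>2 * ?I"
    by (simp add: norm_mult power_mult_distrib)
  also have "\<dots> \<le> ((cmod k)\<^sup>2 + 1) * ?I"
    by (intro mult_right_mono) auto
  also have "\<dots> < \<epsilon>" using lt pos by (simp add: field_simps)
  finally show "\<exists>F c. finite F \<and> F \<subseteq> S \<and> (LINT x|M. (cmod (k * f x - (\<Sum>g\<in>F. c g * g x)))\<^sup>2) < \<epsilon>"
    using F by (intro exI[of _ F] exI[of _ "\<lambda>g. k * c g"]) auto
qed

lemma L2_closure_diff:
  assumes "S \<subseteq> L2_space M" "f \<in> L2_closure M S" "g \<in> L2_closure M S"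
  shows "(\<lambda>x. f x - g x) \<in> L2_closure M S"
  using L2_closure_add[OF assms(1,2) L2_closure_scale[OF assms(3), of "-1"]] by simp

lemma L2_closure_zero: "(\<lambda>x. 0) \<in> L2_closure M S"
  by (rule L2_closureI) (auto intro!: exI[of _ "{}"])

lemma L2_closure_sum:
  assumes "S \<subseteq> L2_space M" "\<And>i. i \<in> I \<Longrightarrow> f i \<in> L2_closure M S"
  shows "(\<lambda>x. \<Sum>i\<in>I. f i x) \<in> L2_closure M S"
  using assms(2)
  by (induction I rule: infinite_finite_induct)
     (auto intro: L2_closure_add[OF assms(1)] L2_closure_zero)

lemma L2_closure_closed:
  assumes S: "S \<subseteq> L2_space M" and f: "f \<in> L2_space M"
    and approx: "\<And>\<epsilon>. \<epsilon> > 0 \<Longrightarrow> \<exists>g\<in>L2_closure M S. (LINT x|M. (cmod (f x - g x))\<^sup>2) < \<epsilon>"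
  shows "f \<in> L2_closure M S"
proof (rule L2_closureI[OF f])
  fix \<epsilon> :: real assume "\<epsilon> > 0"
  then have e: "\<epsilon>/4 > 0" by simp
  obtain g where g: "g \<in> L2_closure M S" "(LINT x|M. (cmod (f x - g x))\<^sup>2) < \<epsilon>/4"
    using approx[OF e] by blast
  obtain F c where F: "finite F" "F \<subseteq> S" "(LINT x|M. (cmod (g x - (\<Sum>h\<in>F. c h * h x)))\<^sup>2) < \<epsilon>/4"
    using L2_closureE[OF g(1) e] .
  have "(LINT x|M. (cmod (f x - (\<Sum>h\<in>F. c h * h x)))\<^sup>2) < \<epsilon>"
    using L2_dist_triangle[OF f L2_closure_L2[OF g(1)] L2_combination[OF F(2) S, of c]] g(2) F(3)
    by linarith
  then show "\<exists>F c. finite F \<and> F \<subseteq> S \<and> (LINT x|M. (cmod (f x - (\<Sum>g\<in>F. c g * g x)))\<^sup>2) < \<epsilon>"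
    using F by blast
qed

text \<open>Dominated convergence makes the error integrals tend to zero, so the closure is stable under
  dominated pointwise limits. This reaches discontinuous and unbounded functions from exponentials.\<close>

lemma L2_closure_dominated:
  fixes w :: "'a \<Rightarrow> real"
  assumes S: "S \<subseteq> L2_space M" and u: "\<And>n. u n \<in> L2_closure M S"
    and lim: "\<And>x. x \<in> space M \<Longrightarrow> (\<lambda>n. u n x) \<longlonglongrightarrow> f x"
    and bound: "\<And>n x. x \<in> space M \<Longrightarrow> cmod (u n x) \<le> w x"
    and w: "integrable M (\<lambda>x. (w x)\<^sup>2)"
  shows "f \<in> L2_closure M S"
proof -
  have um [measurable]: "u n \<in> borel_measurable M" for n
    using u by (intro L2_measurable L2_closure_L2)
  have [measurable]: "f \<in> borel_measurable M"
    by (rule borel_measurable_LIMSEQ_metric[OF um lim])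
  have fw: "cmod (f x) \<le> w x" if "x \<in> space M" for x
    using lim[OF that] bound[OF that] by (intro Lim_bounded[OF tendsto_norm]) auto
  have "integrable M (\<lambda>x. (cmod (f x))\<^sup>2)"
    by (rule Bochner_Integration.integrable_bound[OF w])
       (auto intro!: AE_I2 power_mono fw)
  then have f: "f \<in> L2_space M" by (simp add: L2_space_def)
  have "(\<lambda>n. LINT x|M. (cmod (f x - u n x))\<^sup>2) \<longlonglongrightarrow> (LINT x|M. 0)"
  proof (rule integral_dominated_convergence[where w = "\<lambda>x. 4 * (w x)\<^sup>2"])
    show "AE x in M. (\<lambda>n. (cmod (f x - u n x))\<^sup>2) \<longlonglongrightarrow> 0"
    proof (rule AE_I2)
      fix x assume "x \<in> space M"
      from tendsto_power[OF tendsto_norm[OF tendsto_diff[OF tendsto_const lim[OF this]]], of "f x" 2]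
      show "(\<lambda>n. (cmod (f x - u n x))\<^sup>2) \<longlonglongrightarrow> 0" by simp
    qed
    show "AE x in M. norm ((cmod (f x - u n x))\<^sup>2) \<le> 4 * (w x)\<^sup>2" for n
    proof (rule AE_I2)
      fix x assume x: "x \<in> space M"
      have "cmod (f x - u n x) \<le> 2 * w x"
        using norm_triangle_ineq4[of "f x" "u n x"] fw[OF x] bound[OF x, of n] by linarith
      then have "(cmod (f x - u n x))\<^sup>2 \<le> (2 * w x)\<^sup>2" by (intro power_mono) auto
      then show "norm ((cmod (f x - u n x))\<^sup>2) \<le> 4 * (w x)\<^sup>2" by (simp add: power_mult_distrib)
    qed
  qed (use w in auto)
  then have lim0: "(\<lambda>n. LINT x|M. (cmod (f x - u n x))\<^sup>2) \<longlonglongrightarrow> 0" by simp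
  show ?thesis
  proof (rule L2_closure_closed[OF S f])
    fix \<epsilon> :: real assume "\<epsilon> > 0"
    from order_tendstoD(2)[OF lim0 this] obtain n where "(LINT x|M. (cmod (f x - u n x))\<^sup>2) < \<epsilon>"
      by (auto simp: eventually_sequentially)
    with u show "\<exists>g\<in>L2_closure M S. (LINT x|M. (cmod (f x - g x))\<^sup>2) < \<epsilon>" by blast
  qed
qed

lemma L2_mult_integrable:
  assumes "f \<in> L2_space M" "g \<in> L2_space M"
  shows "integrable M (\<lambda>x. f x * cnj (g x))"
proof -
  have [measurable]: "cnj \<in> borel_measurable borel"
    by (intro borel_measurable_continuous_onI continuous_intros)
  note [measurable] = assms[THEN L2_measurable]
  have "integrable M (\<lambda>x. (cmod (f x))\<^sup>2 + (cmod (g x))\<^sup>2)"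
    using assms by (auto simp: L2_space_def)
  then show ?thesis
  proof (rule Bochner_Integration.integrable_bound)
    have "norm (f x * cnj (g x)) \<le> norm ((cmod (f x))\<^sup>2 + (cmod (g x))\<^sup>2)" for x
    proof -
      have "cmod (f x) * cmod (g x) \<ge> 0" by simp
      then have "cmod (f x) * cmod (g x) \<le> (cmod (f x))\<^sup>2 + (cmod (g x))\<^sup>2"
        using sum_squares_bound[of "cmod (f x)" "cmod (g x)"] by linarith
      then show ?thesis by (simp add: norm_mult)
    qed
    then show "AE x in M. norm (f x * cnj (g x)) \<le> norm ((cmod (f x))\<^sup>2 + (cmod (g x))\<^sup>2)" by simp
  qed auto
qed

text \<open>The Pythagorean identity behind both halves of the theorem. The choice \<open>c g = L2_inner M f g\<close>
  kills the last sum, so \<open>f\<close> is approximated as soon as its squared coefficients sum up to its squared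
  norm; for every other choice the last sum is nonnegative, which bounds the distance of \<open>f\<close> to the span
  from below. By induction: a further vector \<open>g\<close> is orthogonal to the combination already subtracted, hence
  sees the remainder with the coefficient \<open>L2_inner M f g\<close>.\<close>

lemma L2_dist_orthonormal_combination:
  assumes f: "f \<in> L2_space M" and "finite F" "F \<subseteq> L2_space M"
    and "\<And>g. g \<in> F \<Longrightarrow> (LINT x|M. (cmod (g x))\<^sup>2) = 1"
    and "\<And>g h. g \<in> F \<Longrightarrow> h \<in> F \<Longrightarrow> g \<noteq> h \<Longrightarrow> L2_inner M g h = 0"
  shows "(LINT x|M. (cmod (f x - (\<Sum>g\<in>F. c g * g x)))\<^sup>2) =
    (LINT x|M. (cmod (f x))\<^sup>2) - (\<Sum>g\<in>F. (cmod (L2_inner M f g))\<^sup>2)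
      + (\<Sum>g\<in>F. (cmod (c g - L2_inner M f g))\<^sup>2)"
  using assms(2-)
proof (induction F rule: finite_induct)
  case empty
  show ?case by simp
next
  case (insert g F)
  let ?s = "\<lambda>x. \<Sum>h\<in>F. c h * h x"
  let ?r = "\<lambda>x. f x - ?s x"
  let ?w = "L2_inner M f g"
  have s: "?s \<in> L2_space M" using insert.prems(1) by (intro L2_combination[of F F]) auto
  have g: "g \<in> L2_space M" using insert.prems(1) by auto
  note r = L2_diff[OF f s]
  have zero: "(LINT x|M. ?s x * cnj (g x)) = 0"
  proof -
    have "(LINT x|M. ?s x * cnj (g x)) = (LINT x|M. (\<Sum>h\<in>F. c h * (h x * cnj (g x))))"
      by (simp add: sum_distrib_right mult.assoc)
    also have "\<dots> = (\<Sum>h\<in>F. LINT x|M. c h * (h x * cnj (g x)))"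
      using insert.prems(1) by (intro Bochner_Integration.integral_sum)
        (auto intro!: integrable_mult_right L2_mult_integrable)
    also have "\<dots> = (\<Sum>h\<in>F. c h * L2_inner M h g)"
      by (simp add: L2_inner_def)
    also have "\<dots> = 0"
      using insert.prems(3) insert.hyps by (intro sum.neutral) auto
    finally show ?thesis .
  qed
  have rg: "(LINT x|M. ?r x * cnj (g x)) = ?w"
    using L2_mult_integrable[OF f g] L2_mult_integrable[OF s g] zero
    by (simp add: L2_inner_def left_diff_distrib)
  have pt: "(cmod (f x - (\<Sum>h\<in>insert g F. c h * h x)))\<^sup>2 =
      (cmod (?r x))\<^sup>2 - 2 * Re (cnj (c g) * (?r x * cnj (g x))) + (cmod (c g))\<^sup>2 * (cmod (g x))\<^sup>2" for x
  proof -
    have "(cmod (z - u * v))\<^sup>2 = (cmod z)\<^sup>2 - 2 * Re (cnj u * (z * cnj v)) + (cmod u)\<^sup>2 * (cmod v)\<^sup>2" for z u v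
      unfolding cmod_power2 by (simp add: power2_eq_square algebra_simps)
    moreover have "f x - (\<Sum>h\<in>insert g F. c h * h x) = ?r x - c g * g x"
      using insert.hyps by simp
    ultimately show ?thesis by (simp only:)
  qed
  have i: "integrable M (\<lambda>x. cnj (c g) * (?r x * cnj (g x)))"
    by (intro integrable_mult_right L2_mult_integrable r g)
  have "(LINT x|M. (cmod (f x - (\<Sum>h\<in>insert g F. c h * h x)))\<^sup>2) =
     (LINT x|M. (cmod (?r x))\<^sup>2) - 2 * Re (cnj (c g) * ?w) + (cmod (c g))\<^sup>2"
    unfolding pt rg[symmetric]
    using i L2_square_integrable[OF r] L2_square_integrable[OF g] insert.prems(2)[of g]
    by (simp add: integral_Re[OF i, symmetric] del: times_complex.sel complex_cnj_cnj)
  also have "\<dots> = (LINT x|M. (cmod (?r x))\<^sup>2) - (cmod ?w)\<^sup>2 + (cmod (c g - ?w))\<^sup>2"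
    unfolding cmod_power2 by (simp add: power2_eq_square algebra_simps)
  finally show ?case
    using insert.hyps insert.IH insert.prems by simp
qed

section \<open>Density of the exponentials\<close>

lemma e_fun_cis: "e_fun t x = cis (2 * pi * t * x)"
  by (simp add: e_fun_def cis_conv_exp)

lemma e_fun_mult: "e_fun s x * e_fun t x = e_fun (s + t) x"
  by (simp add: e_fun_cis cis_mult algebra_simps)

lemma cmod_e_fun [simp]: "cmod (e_fun t x) = 1"
  by (simp add: e_fun_cis)

lemma e_fun_0 [simp]: "e_fun 0 x = 1"
  by (simp add: e_fun_cis)

lemma e_fun_mult_cnj: "e_fun s x * cnj (e_fun t x) = e_fun (s - t) x"
  by (simp add: e_fun_cis cis_cnj cis_mult algebra_simps)

lemma e_fun_eq_iff [simp]: "e_fun s = e_fun t \<longleftrightarrow> s = t"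
proof
  assume eq: "e_fun s = e_fun t"
  show "s = t"
  proof (rule ccontr)
    assume "s \<noteq> t"
    define x where "x = 1 / (2 * (s - t))"
    have "e_fun (s - t) x = 1"
      using eq e_fun_mult_cnj[of s x t] e_fun_mult_cnj[of t x t] by simp
    moreover have "e_fun (s - t) x = -1"
    proof -
      have "2 * pi * (s - t) * x = pi"
        using \<open>s \<noteq> t\<close> by (simp add: x_def field_simps)
      then show ?thesis unfolding e_fun_cis by (simp only: cis_pi)
    qed
    ultimately show False by simp
  qed
qed auto

lemma e_fun_measurable [measurable]: "e_fun t \<in> borel_measurable borel"
  unfolding e_fun_def by (intro borel_measurable_continuous_onI continuous_intros)

lemma e_fun_L2:
  assumes "finite_measure M" "sets M = sets borel"
  shows "e_fun t \<in> L2_space M"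
  using assms by (intro L2_bounded[where B = 1]) (simp_all cong: measurable_cong_sets)

text \<open>As \<open>n\<close> grows, \<open>sin (d / n)\<close> eventually has the sign of \<open>d\<close>. The ramps \<open>min 1 (max 0 (n\<^sup>2 * u))\<close> turn this
  sign into the values 1 and 0; the factor \<open>n\<^sup>2\<close> is chosen because \<open>n\<^sup>2 * sin (d / n)\<close> tends to infinity
  for \<open>d > 0\<close>. Weierstrass replaces the ramps by polynomials within \<open>1 / n\<close> on \<open>{-1..1}\<close>. A polynomial in
  a sine is a trigonometric polynomial, which is why the step function becomes accessible to exponentials.\<close>

lemma polynomials_approximating_step:
  obtains p :: "nat \<Rightarrow> real \<Rightarrow> real" where
    "\<And>n. real_polynomial_function (p n)"
    "\<And>n u. \<bar>u\<bar> \<le> 1 \<Longrightarrow> \<bar>p n u\<bar> \<le> 2"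
    "\<And>d. d > 0 \<Longrightarrow> (\<lambda>n. p n (sin (d / real (Suc n)))) \<longlonglongrightarrow> 1"
    "\<And>d. d \<le> 0 \<Longrightarrow> (\<lambda>n. p n (sin (d / real (Suc n)))) \<longlonglongrightarrow> 0"
proof -
  define ramp :: "nat \<Rightarrow> real \<Rightarrow> real" where "ramp n u = min 1 (max 0 (real (Suc n) ^ 2 * u))" for n u
  have "\<exists>q. real_polynomial_function q \<and> (\<forall>u\<in>{-1..1}. \<bar>ramp n u - q u\<bar> < 1 / real (Suc n))" for n
    by (rule Stone_Weierstrass_real_polynomial_function[of "{-1..1}" "ramp n" "1 / real (Suc n)"])
       (auto simp: ramp_def intro!: continuous_intros)
  then obtain p where poly: "\<And>n. real_polynomial_function (p n)"
    and close: "\<And>n u. u \<in> {-1..1} \<Longrightarrow> \<bar>ramp n u - p n u\<bar> < 1 / real (Suc n)"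
    by metis
  have ramp01: "0 \<le> ramp n u" "ramp n u \<le> 1" for n u by (auto simp: ramp_def)
  have inv: "(\<lambda>n. 1 / real (Suc n)) \<longlonglongrightarrow> 0" by real_asymp
  have diff0: "(\<lambda>n. p n (sin (d / real (Suc n))) - ramp n (sin (d / real (Suc n)))) \<longlonglongrightarrow> 0" for d
    by (rule Lim_null_comparison[OF _ inv])
       (use close in \<open>auto intro!: always_eventually less_imp_le simp: abs_minus_commute\<close>)
  have transfer: "(\<lambda>n. p n (sin (d / real (Suc n)))) \<longlonglongrightarrow> l"
    if "\<forall>\<^sub>F n in sequentially. ramp n (sin (d / real (Suc n))) = l" for d l
    using tendsto_add[OF that[THEN tendsto_eventually] diff0[of d]] by simp
  show ?thesis
  proof (rule that[OF poly])
    fix n u assume "\<bar>u :: real\<bar> \<le> 1"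
    then have "\<bar>ramp n u - p n u\<bar> < 1 / real (Suc n)" by (intro close) auto
    moreover have "1 / real (Suc n) \<le> 1" by simp
    ultimately show "\<bar>p n u\<bar> \<le> 2" using ramp01[of n u] by linarith
  next
    fix d :: real assume "d > 0"
    then have "filterlim (\<lambda>n. real (Suc n) ^ 2 * sin (d / real (Suc n))) at_top sequentially"
      by real_asymp
    then have "\<forall>\<^sub>F n in sequentially. 1 \<le> real (Suc n) ^ 2 * sin (d / real (Suc n))"
      by (simp add: filterlim_at_top)
    then have "\<forall>\<^sub>F n in sequentially. ramp n (sin (d / real (Suc n))) = 1"
      by (rule eventually_mono) (simp add: ramp_def)
    then show "(\<lambda>n. p n (sin (d / real (Suc n)))) \<longlonglongrightarrow> 1" by (rule transfer)
  next
    fix d :: real assume "d \<le> 0"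
    have "(\<lambda>n. d / real (Suc n)) \<longlonglongrightarrow> 0" by real_asymp
    then have "\<forall>\<^sub>F n in sequentially. - pi < d / real (Suc n)"
      by (rule order_tendstoD) simp
    then have "\<forall>\<^sub>F n in sequentially. ramp n (sin (d / real (Suc n))) = 0"
    proof (rule eventually_mono)
      fix n assume "- pi < d / real (Suc n)"
      moreover have "d / real (Suc n) \<le> 0" using \<open>d \<le> 0\<close> by (simp add: divide_nonpos_pos)
      ultimately have "sin (d / real (Suc n)) \<le> 0"
        using sin_ge_zero[of "- (d / real (Suc n))"] by simp
      then show "ramp n (sin (d / real (Suc n))) = 0"
        by (simp add: ramp_def mult_nonneg_nonpos)
    qed
    then show "(\<lambda>n. p n (sin (d / real (Suc n)))) \<longlonglongrightarrow> 0" by (rule transfer)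
  qed
qed

text \<open>A closure that contains all exponentials need not be visibly closed under products. The free factor
  \<open>e_fun t\<close> makes the induction work: one factor of the sine splits into two exponentials, which merely
  shift \<open>t\<close>.\<close>

lemma sin_power_in_L2_closure:
  assumes S: "S \<subseteq> L2_space M" and e: "\<And>t. e_fun t \<in> L2_closure M S"
  shows "(\<lambda>x. e_fun t x * complex_of_real (sin (2 * pi * s * (x - b))) ^ k) \<in> L2_closure M S"
proof (induction k arbitrary: t)
  case 0
  show ?case using e[of t] by simp
next
  case (Suc k)
  define q where "q = e_fun (-s) b / (2 * \<i>)"
  define r where "r = - e_fun s b / (2 * \<i>)"
  have "complex_of_real (sin (2 * pi * s * (x - b))) = q * e_fun s x + r * e_fun (-s) x" for x
  proof -
    define \<theta> where "\<theta> = 2 * pi * s * (x - b)"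
    have "q * e_fun s x = cis \<theta> / (2 * \<i>)" "r * e_fun (-s) x = - cis (-\<theta>) / (2 * \<i>)"
      by (simp_all add: q_def r_def e_fun_cis cis_mult \<theta>_def algebra_simps)
    then have "q * e_fun s x + r * e_fun (-s) x = (cis \<theta> - cis (-\<theta>)) / (2 * \<i>)"
      by (simp only: diff_divide_distrib) simp
    also have "\<dots> = complex_of_real (sin \<theta>)"
      by (simp add: complex_eq_iff)
    finally show ?thesis by (simp add: \<theta>_def)
  qed
  then have "e_fun t x * complex_of_real (sin (2 * pi * s * (x - b))) ^ Suc k =
      q * (e_fun (t + s) x * complex_of_real (sin (2 * pi * s * (x - b))) ^ k) +
      r * (e_fun (t + (-s)) x * complex_of_real (sin (2 * pi * s * (x - b))) ^ k)" for x
    by (simp only: power_Suc e_fun_mult[symmetric]) (simp add: algebra_simps)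
  then show ?case
    by (simp only:) (intro L2_closure_add[OF S] L2_closure_scale Suc.IH)
qed

lemma indicator_half_line_in_L2_closure:
  assumes M: "finite_measure M" and S: "S \<subseteq> L2_space M" and e: "\<And>t. e_fun t \<in> L2_closure M S"
  shows "indicator {b<..} \<in> L2_closure M S"
proof -
  interpret finite_measure M by (rule M)
  obtain p where poly: "\<And>n. real_polynomial_function (p n)"
    and bound: "\<And>n u. \<bar>u\<bar> \<le> 1 \<Longrightarrow> \<bar>p n u\<bar> \<le> 2"
    and one: "\<And>d. d > 0 \<Longrightarrow> (\<lambda>n. p n (sin (d / real (Suc n)))) \<longlonglongrightarrow> 1"
    and zero: "\<And>d. d \<le> 0 \<Longrightarrow> (\<lambda>n. p n (sin (d / real (Suc n)))) \<longlonglongrightarrow> 0"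
    using polynomials_approximating_step by blast
  let ?u = "\<lambda>n x. complex_of_real (p n (sin ((x - b) / real (Suc n))))"
  show ?thesis
  proof (rule L2_closure_dominated[OF S, where u = ?u and w = "\<lambda>_. 2"])
    fix n
    obtain a m where am: "p n = (\<lambda>u. \<Sum>i\<le>m. a i * u ^ i)"
      using poly[of n] by (auto simp: real_polynomial_function_iff_sum)
    have "(\<lambda>x. \<Sum>i\<le>m. complex_of_real (a i) *
        (e_fun 0 x * complex_of_real (sin (2 * pi * (1 / (2 * pi * real (Suc n))) * (x - b))) ^ i))
      \<in> L2_closure M S"
      by (intro L2_closure_sum[OF S] L2_closure_scale sin_power_in_L2_closure[OF S e])
    then show "?u n \<in> L2_closure M S" by (simp add: am)
  next
    fix x
    show "(\<lambda>n. ?u n x) \<longlonglongrightarrow> indicator {b<..} x"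
      using tendsto_of_real[OF one[of "x - b"], where 'a = complex]
        tendsto_of_real[OF zero[of "x - b"], where 'a = complex]
      by (cases "x > b") simp_all
  next
    fix n x
    show "cmod (?u n x) \<le> 2" by (simp add: bound)
  qed simp
qed

lemma indicator_in_L2_closure:
  fixes M :: "real measure"
  assumes M: "finite_measure M" "sets M = sets borel" and S: "S \<subseteq> L2_space M"
    and e: "\<And>t. e_fun t \<in> L2_closure M S" and A: "A \<in> sets borel"
  shows "indicator A \<in> L2_closure M S"
proof -
  interpret finite_measure M by (rule M)
  have "sets borel = sigma_sets UNIV (range (\<lambda>b::real. {b<..}))"
    by (subst borel_Ioi) simp
  then have gen: "A \<in> sigma_sets UNIV (range (\<lambda>b::real. {b<..}))" using A by simp
  have "{b<..} \<inter> {c<..} = {max b c<..}" for b c :: real by auto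
  then have "Int_stable (range (\<lambda>b::real. {b<..}))"
    by (auto simp: Int_stable_def)
  moreover have "range (\<lambda>b::real. {b<..}) \<subseteq> Pow UNIV" by simp
  ultimately show ?thesis using gen
  proof (induction rule: sigma_sets_induct_disjoint)
    case (basic A)
    then show ?case using indicator_half_line_in_L2_closure[OF M(1) S e] by auto
  next
    case empty
    show ?case using L2_closure_zero[of M S] by simp
  next
    case (compl A)
    have "(\<lambda>x. e_fun 0 x - indicator A x) \<in> L2_closure M S"
      by (intro L2_closure_diff[OF S e] compl.IH)
    moreover have "(\<lambda>x. e_fun 0 x - indicator A x) = (indicator (UNIV - A) :: real \<Rightarrow> complex)"
      by (auto simp: indicator_def)
    ultimately show ?case by simp
  next
    case (union A)
    show ?case
    proof (rule L2_closure_dominated[OF S, where w = "\<lambda>_. 1"])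
      fix n :: nat
      have "(\<lambda>x. \<Sum>i<n. indicator (A i) x) \<in> L2_closure M S"
        by (intro L2_closure_sum[OF S] union.IH)
      also have "(\<lambda>x. \<Sum>i<n. indicator (A i) x) = (indicator (\<Union>i<n. A i) :: real \<Rightarrow> complex)"
        using union.hyps by (auto simp: fun_eq_iff disjoint_family_on_def indicator_UN_disjoint)
      finally show "indicator (\<Union>i<n. A i) \<in> L2_closure M S" .
    next
      fix x show "(\<lambda>n. indicator (\<Union>i<n. A i) x) \<longlonglongrightarrow> (indicator (\<Union>i. A i) x :: complex)"
        by (rule LIMSEQ_indicator_UN)
    next
      fix n x
      have "cmod (indicator B x) \<le> 1" for B :: "real set" by (simp add: indicator_def)
      then show "cmod (indicator (\<Union>i<n. A i) x) \<le> 1" .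
    next
      show "integrable M (\<lambda>x. 1\<^sup>2 :: real)" by simp
    qed
  qed
qed

text \<open>Density of the exponentials in \<open>L\<^sup>2\<close> of an arbitrary finite Borel measure on the line, in the form
  needed below: the exponentials have only to lie in the closure of the span of \<open>S\<close>. Half-lines generate
  the Borel sets and are stable under intersection, so a Dynkin argument passes from their indicators to
  those of all Borel sets, and simple functions give the rest.\<close>

lemma L2_closure_eq_L2_space:
  fixes M :: "real measure"
  assumes M: "finite_measure M" "sets M = sets borel" and S: "S \<subseteq> L2_space M"
    and e: "\<And>t. e_fun t \<in> L2_closure M S"
  shows "L2_closure M S = L2_space M"
proof (intro equalityI subsetI)
  fix f assume f: "f \<in> L2_space M"
  obtain s where simple: "\<And>n. simple_function M (s n)"
    and lim: "\<And>x. x \<in> space M \<Longrightarrow> (\<lambda>n. s n x) \<longlonglongrightarrow> f x"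
    and le: "\<And>n x. x \<in> space M \<Longrightarrow> cmod (s n x) \<le> 2 * cmod (f x)"
    using borel_measurable_implies_sequence_metric[OF L2_measurable[OF f], of 0]
    by (simp only: dist_norm diff_zero) blast
  have sp: "space M = UNIV" using sets_eq_imp_space_eq[OF M(2)] by simp
  show "f \<in> L2_closure M S"
  proof (rule L2_closure_dominated[OF S _ lim le])
    fix n
    have "(\<lambda>x. \<Sum>y\<in>range (s n). y * indicator (s n -` {y}) x) \<in> L2_closure M S"
    proof (intro L2_closure_sum[OF S] L2_closure_scale indicator_in_L2_closure[OF M S e])
      fix y
      show "s n -` {y} \<in> sets borel"
        using simple_functionD(2)[OF simple[of n], of "{y}"] M(2) sp by simp
    qed
    also have "(\<lambda>x. \<Sum>y\<in>range (s n). y * indicator (s n -` {y}) x) = s n"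
    proof
      fix x
      have "finite (range (s n))" using simple_functionD(1)[OF simple[of n]] sp by simp
      then show "(\<Sum>y\<in>range (s n). y * indicator (s n -` {y}) x) = s n x"
        by (simp add: indicator_def if_distrib[of "\<lambda>z. _ * z"] cong: if_cong)
    qed
    finally show "s n \<in> L2_closure M S" .
  next
    show "integrable M (\<lambda>x. (2 * cmod (f x))\<^sup>2)"
      using L2_square_integrable[OF f] by (simp add: power_mult_distrib)
  qed
qed (rule L2_closure_L2)

section \<open>Infinite products of cosines\<close>

text \<open>The function \<open>G\<close> abstracts \<open>u \<mapsto> \<bar>F (u / (2 * a))\<bar>\<^sup>2\<close>, with \<open>F\<close> the Fourier transform of the invariant
  measure. In the unit \<open>1 / (2 * a)\<close> the zeros of the cosine factor are the odd integers and its square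
  has period 2, so \<open>a\<close> disappears from the analysis. Iterating the last assumption gives
  \<open>G u = (\<Prod>k. (cos (pi * u / (2 * R ^ k)))\<^sup>2)\<close>.\<close>

locale cosine_product =
  fixes R :: int and G :: "real \<Rightarrow> real"
  assumes abs_R: "\<bar>R\<bar> \<ge> 2"
    and G_nonneg: "G u \<ge> 0"
    and G_le_1: "G u \<le> 1"
    and G_0: "G 0 = 1"
    and G_cont: "continuous_on UNIV G"
    and G_refine: "G u = (cos (pi * u / 2))\<^sup>2 * G (u / of_int R)"
begin

definition cos_prod :: "nat \<Rightarrow> real \<Rightarrow> real" where
  "cos_prod n u = (\<Prod>k<n. (cos (pi * (u / of_int R ^ k) / 2))\<^sup>2)"

lemma cos_prod_Suc: "cos_prod (Suc n) u = (cos (pi * u / 2))\<^sup>2 * cos_prod n (u / of_int R)"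
  by (simp add: cos_prod_def prod.lessThan_Suc_shift del: prod.lessThan_Suc)

lemma cos_prod_nonneg: "cos_prod n u \<ge> 0"
  by (simp add: cos_prod_def prod_nonneg)

lemma G_cos_prod: "G u = cos_prod n u * G (u / of_int R ^ n)"
proof (induction n arbitrary: u)
  case 0
  show ?case by (simp add: cos_prod_def)
next
  case (Suc n)
  have "G u = (cos (pi * u / 2))\<^sup>2 * G (u / of_int R)" by (rule G_refine)
  also have "G (u / of_int R) = cos_prod n (u / of_int R) * G (u / of_int R / of_int R ^ n)"
    by (rule Suc.IH)
  finally show ?case by (simp add: cos_prod_Suc mult.assoc)
qed

lemma G_le_cos_prod: "G u \<le> cos_prod n u"
  using mult_left_mono[OF G_le_1 cos_prod_nonneg, of n u "u / of_int R ^ n"] G_cos_prod[of u n]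
  by simp

lemma G_scaled_tendsto: "(\<lambda>n. G (u / of_int R ^ n)) \<longlonglongrightarrow> 1"
proof -
  have "1 < \<bar>real_of_int R\<bar>" using abs_R by linarith
  then have "(\<lambda>n. inverse (real_of_int R) ^ n) \<longlonglongrightarrow> 0"
    by (intro LIMSEQ_power_zero) (simp add: inverse_less_1_iff)
  then have "(\<lambda>n. inverse (real_of_int R ^ n)) \<longlonglongrightarrow> 0"
    by (simp add: power_inverse)
  then have "(\<lambda>n. u * inverse (real_of_int R ^ n)) \<longlonglongrightarrow> u * 0"
    by (intro tendsto_intros)
  then have "(\<lambda>n. u / of_int R ^ n) \<longlonglongrightarrow> 0" by (simp add: divide_inverse)
  moreover have "isCont G 0" using G_cont by (simp add: continuous_on_eq_continuous_at)
  ultimately show ?thesis using isCont_tendsto_compose[of 0 G] G_0 by metis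
qed

text \<open>The tail \<open>G (u / R ^ n)\<close> of the product tends to 1, so a zero of \<open>G\<close> is a zero of one of the cosine
  factors.\<close>

lemma G_eq_0D:
  assumes "G u = 0"
  obtains k j where "odd j" "u / of_int R ^ k = of_int j"
proof -
  have "\<forall>\<^sub>F n in sequentially. G (u / of_int R ^ n) > 0"
    using G_scaled_tendsto by (rule order_tendstoD) simp
  then obtain n where "G (u / of_int R ^ n) > 0"
    by (auto simp: eventually_sequentially)
  then have "cos_prod n u = 0" using G_cos_prod[of u n] assms by simp
  then obtain k where "cos (pi * (u / of_int R ^ k) / 2) = 0"
    by (auto simp: cos_prod_def)
  then obtain j where j: "odd j" "pi * (u / of_int R ^ k) / 2 = of_int j * (pi / 2)"
    unfolding cos_zero_iff_int by blast
  have "v = w" if "pi * v / 2 = w * (pi / 2)" for v w :: real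
    using that by simp
  from this[OF j(2)] have "u / of_int R ^ k = of_int j" .
  with j(1) show ?thesis by (rule that)
qed

lemma G_odd: "odd j \<Longrightarrow> G (of_int j) = 0"
proof -
  assume "odd j"
  then have "cos (pi * of_int j / 2) = 0" 
    unfolding cos_zero_iff_int by (intro exI[of _ j]) simp
  then show ?thesis by (subst G_refine) simp
qed

lemma G_pos:
  assumes "\<bar>u\<bar> < 1"
  shows "G u > 0"
proof (rule ccontr)
  assume "\<not> G u > 0"
  then have "G u = 0" using G_nonneg[of u] by simp
  then obtain k j where j: "odd j" "u / of_int R ^ k = of_int j" by (rule G_eq_0D)
  have "\<bar>u / of_int R ^ k\<bar> \<le> \<bar>u\<bar>"
    using abs_R by (simp add: power_abs divide_le_eq mult_le_cancel_left1 one_le_power)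
  then have "\<bar>j\<bar> < 1" using assms j(2) by simp
  with j(1) show False by simp
qed

lemma G_zero_odd:
  assumes "odd R" "G u = 0"
  obtains j where "odd j" "u = of_int j"
proof -
  obtain k j where j: "odd j" "u / of_int R ^ k = of_int j" using assms(2) by (rule G_eq_0D)
  then have "u = of_int (j * R ^ k)" using abs_R by (auto simp: field_simps)
  with assms(1) j(1) show ?thesis by (intro that[of "j * R ^ k"]) auto
qed

text \<open>At \<open>u = 2\<close> the first factor of the product is 1, but the second is \<open>(cos (pi / R))\<^sup>2 < 1\<close>.\<close>

lemma G_2_less_1: "G 2 < 1"
proof -
  have "G 2 = (cos (pi / of_int R))\<^sup>2 * G (2 / of_int R / of_int R)"
    by (subst G_refine, subst G_refine) simp
  also have "\<dots> \<le> (cos (pi / of_int R))\<^sup>2"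
    by (intro mult_left_le G_le_1) simp
  also have "\<dots> < 1"
  proof -
    have "sin (pi / of_int R) \<noteq> 0"
    proof
      assume "sin (pi / of_int R) = 0"
      then obtain i :: int where "pi / of_int R = of_int i * pi" by (auto simp: sin_zero_iff_int2)
      then have "real_of_int (i * R) = 1" using abs_R by (auto simp: field_simps)
      then have "i * R = 1" by linarith
      then have "R dvd 1" by (metis dvd_triv_right)
      then show False using abs_R by simp
    qed
    then have "(sin (pi / of_int R))\<^sup>2 > 0" by simp
    then show ?thesis using sin_cos_squared_add[of "pi / of_int R"] by linarith
  qed
  finally show ?thesis .
qed

end

section \<open>Sums over integers with binary digits in an even base\<close>

text \<open>The integers \<open>\<Sum>k<n. l k * R ^ k\<close> with digits \<open>l k \<in> {0, 1}\<close>, built by prepending a lowest digit,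
  because this matches the step from \<open>u\<close> to \<open>u / R\<close> in the refinement equation.\<close>

primrec digit_sums :: "int \<Rightarrow> nat \<Rightarrow> int set" where
  "digit_sums R 0 = {0}"
| "digit_sums R (Suc n) = (\<lambda>\<gamma>. R * \<gamma>) ` digit_sums R n \<union> (\<lambda>\<gamma>. 1 + R * \<gamma>) ` digit_sums R n"

lemma finite_digit_sums [simp]: "finite (digit_sums R n)"
  by (induction n) auto

lemma digit_sums_mono_Suc: "digit_sums R n \<subseteq> digit_sums R (Suc n)"
proof (induction n)
  case (Suc n)
  have "digit_sums R (Suc n) \<subseteq>
      (\<lambda>\<gamma>. R * \<gamma>) ` digit_sums R (Suc n) \<union> (\<lambda>\<gamma>. 1 + R * \<gamma>) ` digit_sums R (Suc n)"
    using Suc.IH unfolding digit_sums.simps(2)[of R n] by blast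
  then show ?case by (simp only: digit_sums.simps(2)[of R "Suc n"])
qed auto

lemma digit_sums_mono: "m \<le> n \<Longrightarrow> digit_sums R m \<subseteq> digit_sums R n"
  by (rule lift_Suc_mono_le[of "digit_sums R"]) (rule digit_sums_mono_Suc)

lemma digit_sums_SucE:
  assumes "\<gamma> \<in> digit_sums R (Suc n)"
  obtains l \<gamma>' where "l \<in> {0, 1}" "\<gamma>' \<in> digit_sums R n" "\<gamma> = l + R * \<gamma>'"
proof -
  from assms consider \<gamma>' where "\<gamma>' \<in> digit_sums R n" "\<gamma> = 0 + R * \<gamma>'"
    | \<gamma>' where "\<gamma>' \<in> digit_sums R n" "\<gamma> = 1 + R * \<gamma>'" by auto
  then show ?thesis by cases (use that in blast)+
qed

locale even_cosine_product = cosine_product +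
  assumes even_R: "even R" and abs_R4: "\<bar>R\<bar> \<ge> 4"
begin

text \<open>Strip equal lowest digits; this divides the difference by \<open>R\<close>, and \<open>G\<close> inherits the zero by the
  refinement equation. At the first place where the digits differ the difference is odd, since \<open>R\<close> is
  even, and \<open>G\<close> vanishes at odd integers.\<close>

lemma G_digit_sums_diff:
  assumes "\<gamma> \<in> digit_sums R n" "\<delta> \<in> digit_sums R n" "\<gamma> \<noteq> \<delta>"
  shows "G (of_int (\<gamma> - \<delta>)) = 0"
  using assms
proof (induction n arbitrary: \<gamma> \<delta>)
  case 0
  then show ?case by simp
next
  case (Suc n)
  have R0: "R \<noteq> 0" using abs_R by auto
  obtain l \<gamma>' where g: "l \<in> {0, 1}" "\<gamma>' \<in> digit_sums R n" "\<gamma> = l + R * \<gamma>'"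
    using Suc.prems(1) by (rule digit_sums_SucE)
  obtain m \<delta>' where d: "m \<in> {0, 1}" "\<delta>' \<in> digit_sums R n" "\<delta> = m + R * \<delta>'"
    using Suc.prems(2) by (rule digit_sums_SucE)
  show ?case
  proof (cases "l = m")
    case True
    then have "G (of_int (\<gamma>' - \<delta>')) = 0"
      using Suc.IH[OF g(2) d(2)] Suc.prems(3) g(3) d(3) by auto
    moreover have "real_of_int (\<gamma> - \<delta>) / of_int R = of_int (\<gamma>' - \<delta>')"
      using True g(3) d(3) R0 by (simp add: field_simps)
    ultimately show ?thesis by (subst G_refine) simp
  next
    case False
    then have "odd (\<gamma> - \<delta>)" using g d even_R by auto
    then show ?thesis by (rule G_odd)
  qed
qed

text \<open>For \<open>G\<close> coming from the measure, orthonormality makes this the squared norm of the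
  projection of the exponential of frequency \<open>x\<close> to the span of those with frequencies in
  \<open>digit_sums R n\<close>.\<close>

definition spectral_sum :: "nat \<Rightarrow> real \<Rightarrow> real" where
  "spectral_sum n x = (\<Sum>\<gamma>\<in>digit_sums R n. G (x - of_int \<gamma>))"

text \<open>Sort the frequencies by their lowest digit. Since \<open>R * \<gamma>\<close> is even, it drops out of the squared cosine;
  the digit 1 shifts the argument by half a period and turns the cosine into a sine. The weights sum to 1,
  so \<open>spectral_sum\<close> is obtained by repeated averaging.\<close>

lemma spectral_sum_Suc:
  "spectral_sum (Suc n) x = (cos (pi * x / 2))\<^sup>2 * spectral_sum n (x / of_int R) +
    (sin (pi * x / 2))\<^sup>2 * spectral_sum n ((x - 1) / of_int R)"
proof -
  have R0: "R \<noteq> 0" using abs_R by auto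
  have shift: "G (y - of_int (R * \<gamma>)) = (cos (pi * y / 2))\<^sup>2 * G (y / of_int R - of_int \<gamma>)" for y \<gamma>
  proof -
    obtain k where k: "R * \<gamma> = 2 * k" using even_R by (metis dvdE dvd_mult2)
    have "pi * (y - of_int (R * \<gamma>)) / 2 = pi * y / 2 - of_int k * pi"
      unfolding k by (simp add: field_simps)
    then have "(cos (pi * (y - of_int (R * \<gamma>)) / 2))\<^sup>2 = (cos (pi * y / 2))\<^sup>2"
      by (simp only: cos_diff) (simp add: power_mult_distrib mult.commute[of _ pi])
    moreover have "(y - of_int (R * \<gamma>)) / of_int R = y / of_int R - of_int \<gamma>"
      using R0 by (simp add: field_simps)
    ultimately show ?thesis by (subst G_refine) simp
  qed
  have sin2: "(cos (pi * (x - 1) / 2))\<^sup>2 = (sin (pi * x / 2))\<^sup>2"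
    by (simp add: right_diff_distrib diff_divide_distrib cos_diff)
  have "R * \<gamma> \<noteq> 1 + R * \<delta>" for \<gamma> \<delta>
    using even_R by (metis dvd_mult2 even_plus_one_iff add.commute)
  then have disj: "(\<lambda>\<gamma>. R * \<gamma>) ` digit_sums R n \<inter> (\<lambda>\<gamma>. 1 + R * \<gamma>) ` digit_sums R n = {}" by blast
  have "spectral_sum (Suc n) x = (\<Sum>\<gamma>\<in>digit_sums R n. G (x - of_int (R * \<gamma>))) +
      (\<Sum>\<gamma>\<in>digit_sums R n. G (x - of_int (1 + R * \<gamma>)))"
    unfolding spectral_sum_def digit_sums.simps(2)
    by (subst sum.union_disjoint[OF _ _ disj], simp_all)
       (subst (1 2) sum.reindex, use R0 in \<open>auto intro!: inj_onI\<close>)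
  also have "(\<Sum>\<gamma>\<in>digit_sums R n. G (x - of_int (R * \<gamma>))) = (cos (pi * x / 2))\<^sup>2 * spectral_sum n (x / of_int R)"
    by (simp only: shift spectral_sum_def sum_distrib_left)
  also have "(\<Sum>\<gamma>\<in>digit_sums R n. G (x - of_int (1 + R * \<gamma>))) =
      (sin (pi * x / 2))\<^sup>2 * spectral_sum n ((x - 1) / of_int R)"
    using shift[of "x - 1"] by (simp add: spectral_sum_def sum_distrib_left sin2 diff_diff_eq)
  finally show ?thesis .
qed

lemma spectral_sum_le_1: "spectral_sum n x \<le> 1"
proof (induction n arbitrary: x)
  case 0
  show ?case by (simp add: spectral_sum_def G_le_1)
next
  case (Suc n)
  have "spectral_sum (Suc n) x \<le> (cos (pi * x / 2))\<^sup>2 * 1 + (sin (pi * x / 2))\<^sup>2 * 1"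
    unfolding spectral_sum_Suc by (intro add_mono mult_left_mono Suc.IH) auto
  then show ?case by simp
qed

lemma spectral_sum_mono: "m \<le> n \<Longrightarrow> spectral_sum m x \<le> spectral_sum n x"
  unfolding spectral_sum_def by (intro sum_mono2 digit_sums_mono G_nonneg) auto

definition spectral_sum_lim :: "real \<Rightarrow> real" where
  "spectral_sum_lim x = lim (\<lambda>n. spectral_sum n x)"

lemma spectral_sum_tendsto: "(\<lambda>n. spectral_sum n x) \<longlonglongrightarrow> spectral_sum_lim x"
proof -
  have "incseq (\<lambda>n. spectral_sum n x)" by (auto simp: incseq_def spectral_sum_mono)
  then obtain L where "(\<lambda>n. spectral_sum n x) \<longlonglongrightarrow> L"
    by (rule incseq_convergent[of _ 1]) (simp_all add: spectral_sum_le_1)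
  then show ?thesis unfolding spectral_sum_lim_def by (simp add: limI)
qed

lemma spectral_sum_lim_le_1: "spectral_sum_lim x \<le> 1"
  by (rule Lim_bounded[OF spectral_sum_tendsto, of 0]) (simp add: spectral_sum_le_1)

lemma G_le_spectral_sum_lim: "G x \<le> spectral_sum_lim x"
proof (rule Lim_bounded2[OF spectral_sum_tendsto, of 0])
  show "\<forall>n\<ge>0. G x \<le> spectral_sum n x" using spectral_sum_mono[of 0 _ x] by (simp add: spectral_sum_def)
qed

lemma spectral_sum_lim_refine:
  "spectral_sum_lim x = (cos (pi * x / 2))\<^sup>2 * spectral_sum_lim (x / of_int R) +
      (sin (pi * x / 2))\<^sup>2 * spectral_sum_lim ((x - 1) / of_int R)"
proof (rule LIMSEQ_unique)
  show "(\<lambda>n. spectral_sum (Suc n) x) \<longlonglongrightarrow> spectral_sum_lim x"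
    using spectral_sum_tendsto by (rule LIMSEQ_Suc)
  show "(\<lambda>n. spectral_sum (Suc n) x) \<longlonglongrightarrow>
      (cos (pi * x / 2))\<^sup>2 * spectral_sum_lim (x / of_int R) +
      (sin (pi * x / 2))\<^sup>2 * spectral_sum_lim ((x - 1) / of_int R)"
    unfolding spectral_sum_Suc by (intro tendsto_intros spectral_sum_tendsto)
qed

lemma abs_divide_R_le:
  fixes y c :: real
  assumes y: "\<bar>y\<bar> \<le> 4 * c"
  shows "\<bar>y / of_int R\<bar> \<le> c"
proof -
  have R: "real_of_int \<bar>R\<bar> \<ge> 4" using abs_R4 by linarith
  have "4 * c \<le> \<bar>of_int R\<bar> * c"
    using R y by (intro mult_right_mono) auto
  then have "\<bar>y\<bar> \<le> \<bar>of_int R\<bar> * c" using y by linarith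
  then show ?thesis using R by (simp add: divide_le_eq mult.commute)
qed

text \<open>Let \<open>M\<close> be the supremum of the defect \<open>1 - spectral_sum_lim x\<close> over the interval \<open>{-1/2..1/2}\<close>. Both
  contractions \<open>x \<mapsto> x / R\<close> and \<open>x \<mapsto> (x - 1) / R\<close> map the interval into itself, because \<open>\<bar>R\<bar> \<ge> 4\<close>. So the
  defect at \<open>x\<close> is an average of defects at most \<open>M\<close>, and following the first contraction \<open>n\<close> times leads,
  with weight \<open>cos_prod n x \<ge> G x\<close>, to a point near 0, where the defect is almost 0 as it is bounded by
  \<open>1 - G\<close>. Since \<open>G\<close> is bounded away from 0 on the interval, the defect stays below \<open>M\<close> by a fixed multiple
  of \<open>M\<close>, which forces \<open>M = 0\<close>.\<close>

lemma spectral_sum_lim_near_0: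
  assumes "\<bar>x\<bar> \<le> 1/2"
  shows "spectral_sum_lim x = 1"
proof -
  let ?X = "{-1/2..1/2 :: real}"
  define M where "M = (SUP x\<in>?X. 1 - spectral_sum_lim x)"
  have bdd: "bdd_above ((\<lambda>x. 1 - spectral_sum_lim x) ` ?X)"
    using order_trans[OF G_nonneg G_le_spectral_sum_lim] by (intro bdd_aboveI[of _ 1]) auto
  have le_M: "1 - spectral_sum_lim x \<le> M" if "x \<in> ?X" for x
    unfolding M_def by (rule cSUP_upper[OF that bdd])
  have X_step: "x / of_int R \<in> ?X" "(x - 1) / of_int R \<in> ?X" if "x \<in> ?X" for x
  proof -
    have X_iff: "y \<in> ?X \<longleftrightarrow> \<bar>y\<bar> \<le> 1/2" for y by (auto simp: abs_le_iff)
    show "x / of_int R \<in> ?X" "(x - 1) / of_int R \<in> ?X"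
      using that unfolding X_iff by (intro abs_divide_R_le; linarith)+
  qed
  have iter: "M - (1 - spectral_sum_lim x) \<ge>
      cos_prod n x * (M - (1 - spectral_sum_lim (x / of_int R ^ n)))" if "x \<in> ?X" for n x
    using that
  proof (induction n arbitrary: x)
    case 0
    show ?case by (simp add: cos_prod_def)
  next
    case (Suc n)
    let ?C = "(cos (pi * x / 2))\<^sup>2" and ?S = "(sin (pi * x / 2))\<^sup>2"
    have one: "?C + ?S = 1" by simp
    have "M - (1 - spectral_sum_lim x) = ?C * (M - (1 - spectral_sum_lim (x / of_int R))) +
        ?S * (M - (1 - spectral_sum_lim ((x - 1) / of_int R)))"
      by (subst spectral_sum_lim_refine) (use one in algebra)
    also have "\<dots> \<ge> ?C * (M - (1 - spectral_sum_lim (x / of_int R)))"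
      using le_M[OF X_step(2)[OF Suc.prems]] by simp
    also have "?C * (M - (1 - spectral_sum_lim (x / of_int R))) \<ge>
        ?C * (cos_prod n (x / of_int R) * (M - (1 - spectral_sum_lim (x / of_int R / of_int R ^ n))))"
      by (intro mult_left_mono Suc.IH X_step(1) Suc.prems) simp
    finally show ?case by (simp add: cos_prod_Suc mult.assoc)
  qed
  obtain x0 where x0: "x0 \<in> ?X" "\<And>x. x \<in> ?X \<Longrightarrow> G x0 \<le> G x"
    using continuous_attains_inf[of ?X G] continuous_on_subset[OF G_cont subset_UNIV, of ?X]
    by (simp only: compact_Icc) fastforce
  have pos: "G x0 > 0" using x0(1) by (intro G_pos) auto
  have "M \<le> 0"
  proof (rule ccontr)
    assume "\<not> M \<le> 0"
    then have M: "M > 0" by simp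
    \<comment> \<open>The point \<open>x / R ^ n\<close> near 0 has a defect below \<open>M / 2\<close>, which gains \<open>M / 2\<close> times its weight.\<close>
    have "1 - spectral_sum_lim x \<le> M - G x0 * (M / 2)" if x: "x \<in> ?X" for x
    proof -
      have "\<forall>\<^sub>F n in sequentially. G (x / of_int R ^ n) > 1 - M / 2"
        using G_scaled_tendsto by (rule order_tendstoD) (use M in simp)
      then obtain n where n: "G (x / of_int R ^ n) > 1 - M / 2"
        by (auto simp: eventually_sequentially)
      have "G x0 * (M / 2) \<le> cos_prod n x * (M / 2)"
        using x0(2)[OF x] G_le_cos_prod[of x n] M by (intro mult_right_mono) auto
      also have "\<dots> \<le> cos_prod n x * (M - (1 - spectral_sum_lim (x / of_int R ^ n)))"
        using n G_le_spectral_sum_lim[of "x / of_int R ^ n"] by (intro mult_left_mono cos_prod_nonneg) auto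
      also have "\<dots> \<le> M - (1 - spectral_sum_lim x)" by (rule iter[OF x])
      finally show ?thesis by simp
    qed
    then have "M \<le> M - G x0 * (M / 2)" unfolding M_def by (intro cSUP_least) auto
    moreover have "G x0 * (M / 2) > 0" using pos M by simp
    ultimately show False by linarith
  qed
  moreover have "1 - spectral_sum_lim x \<le> M" using assms by (intro le_M) auto
  ultimately show ?thesis using spectral_sum_lim_le_1[of x] by linarith
qed

text \<open>Both contractions bring any point into \<open>{-1/2..1/2}\<close> after finitely many steps: for \<open>c \<ge> 1/2\<close> the
  bound \<open>\<bar>x\<bar> \<le> 4/3 * c\<close> gives \<open>(\<bar>x\<bar> + 1) / 4 \<le> c\<close>.\<close>

lemma spectral_sum_lim_eq_1: "spectral_sum_lim x = 1"
proof -
  have "\<bar>x\<bar> \<le> (4/3) ^ n / 2 \<Longrightarrow> spectral_sum_lim x = 1" for n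
  proof (induction n arbitrary: x)
    case 0
    then show ?case by (intro spectral_sum_lim_near_0) simp
  next
    case (Suc n)
    have "(1 :: real) \<le> (4/3) ^ n" by (rule one_le_power) simp
    then have "\<bar>x\<bar> \<le> 4 * ((4/3) ^ n / 2)" "\<bar>x - 1\<bar> \<le> 4 * ((4/3) ^ n / 2)"
      using Suc.prems abs_triangle_ineq4[of x 1] unfolding power_Suc abs_one by linarith+
    then have "spectral_sum_lim (x / of_int R) = 1" "spectral_sum_lim ((x - 1) / of_int R) = 1"
      by (intro Suc.IH abs_divide_R_le; simp)+
    then show ?case by (subst spectral_sum_lim_refine) simp
  qed
  moreover obtain n where "2 * \<bar>x\<bar> < (4/3) ^ n"
    using real_arch_pow[of "4/3" "2 * \<bar>x\<bar>"] by auto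
  ultimately show ?thesis by (metis less_imp_le less_divide_eq_numeral1(1) mult.commute)
qed

lemma spectral_sum_tendsto_1: "(\<lambda>n. \<Sum>\<gamma>\<in>digit_sums R n. G (x - of_int \<gamma>)) \<longlonglongrightarrow> 1"
  using spectral_sum_tendsto[of x] by (simp add: spectral_sum_def spectral_sum_lim_eq_1)

end

section \<open>The Fourier transform of the invariant measure\<close>

lemma cmod_1_plus_cis: "(cmod (1 + cis t))\<^sup>2 = 4 * (cos (t / 2))\<^sup>2"
proof -
  have "(cmod (1 + cis t))\<^sup>2 = 2 + 2 * cos t"
    using sin_cos_squared_add[of t] by (simp add: cmod_power2 power2_sum)
  also have "cos t = 2 * (cos (t / 2))\<^sup>2 - 1" using cos_double_cos[of "t / 2"] by simp
  finally show ?thesis by simp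
qed

locale invariant_measure =
  fixes R :: int and a :: real and \<mu> :: "real measure"
  assumes abs_R: "\<bar>R\<bar> \<ge> 2" and a_nonzero: "a \<noteq> 0"
    and invariant: "invariant_prob_measure R a \<mu>"
begin

sublocale prob_space \<mu>
  using invariant by (simp add: invariant_prob_measure_def)

lemma sets_\<mu> [measurable_cong, simp]: "sets \<mu> = sets borel"
  using invariant by (simp add: invariant_prob_measure_def)

lemma space_\<mu> [simp]: "space \<mu> = UNIV"
  using sets_eq_imp_space_eq[OF sets_\<mu>] by simp

lemma prob_UNIV [simp]: "prob UNIV = 1"
  using prob_space by simp

lemma sigma_map_measurable [measurable]: "sigma_map R b \<in> borel_measurable borel"
  unfolding sigma_map_def by measurable

definition branch :: "real \<Rightarrow> real measure" where
  "branch b = distr \<mu> borel (sigma_map R b)"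

lemma sets_branch [measurable_cong, simp]: "sets (branch b) = sets borel"
  by (simp add: branch_def)

lemma prob_space_branch: "prob_space (branch b)"
  unfolding branch_def by (rule prob_space_distr) simp

lemma emeasure_invariant:
  assumes "A \<in> sets borel"
  shows "2 * emeasure \<mu> A = emeasure (branch 0) A + emeasure (branch a) A"
proof -
  interpret B0: prob_space "branch 0" by (rule prob_space_branch)
  interpret Ba: prob_space "branch a" by (rule prob_space_branch)
  have "2 * measure \<mu> A = measure (branch 0) A + measure (branch a) A"
    using invariant assms a_nonzero
    by (auto simp: invariant_prob_measure_def branch_def)
  then have "ennreal (2 * measure \<mu> A) = ennreal (measure (branch 0) A + measure (branch a) A)"
    by simp
  then show ?thesis
    by (simp add: ennreal_mult emeasure_eq_measure B0.emeasure_eq_measure Ba.emeasure_eq_measure)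
qed

text \<open>The invariance is assumed for sets only; it passes to nonnegative functions by approximation, to
  real functions with values in \<open>{-1..1}\<close> by adding 1, and to complex ones by real and imaginary parts.\<close>

lemma nn_integral_invariant:
  assumes "f \<in> borel_measurable borel"
  shows "2 * (\<integral>\<^sup>+x. f x \<partial>\<mu>) = (\<integral>\<^sup>+x. f x \<partial>branch 0) + (\<integral>\<^sup>+x. f x \<partial>branch a)"
  using assms
proof (induction rule: borel_measurable_induct)
  case (cong f g)
  then show ?case by (simp cong: nn_integral_cong)
next
  case (set A)
  then show ?case by (simp add: emeasure_invariant)
next
  case (mult u c)
  have "2 * (c * (\<integral>\<^sup>+x. u x \<partial>\<mu>)) = c * (2 * (\<integral>\<^sup>+x. u x \<partial>\<mu>))" by (simp add: mult_ac)
  also have "\<dots> = c * (\<integral>\<^sup>+x. u x \<partial>branch 0) + c * (\<integral>\<^sup>+x. u x \<partial>branch a)"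
    by (simp add: mult.IH distrib_left)
  finally show ?case using mult.hyps by (simp add: nn_integral_cmult)
next
  case (add u v)
  have "2 * ((\<integral>\<^sup>+x. u x \<partial>\<mu>) + (\<integral>\<^sup>+x. v x \<partial>\<mu>)) =
      ((\<integral>\<^sup>+x. u x \<partial>branch 0) + (\<integral>\<^sup>+x. u x \<partial>branch a)) + ((\<integral>\<^sup>+x. v x \<partial>branch 0) + (\<integral>\<^sup>+x. v x \<partial>branch a))"
    by (simp add: add.IH distrib_left)
  then show ?case using add.hyps by (simp add: nn_integral_add add_ac)
next
  case (seq U)
  have SUP: "(\<integral>\<^sup>+x. (SUP i. U i) x \<partial>M) = (SUP i. \<integral>\<^sup>+x. U i x \<partial>M)" if "sets M = sets borel" for M
    unfolding SUP_apply using seq.hyps that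
    by (intro nn_integral_monotone_convergence_SUP) (simp_all cong: measurable_cong_sets)
  have mono: "incseq (\<lambda>i. \<integral>\<^sup>+x. U i x \<partial>M)" for M
    using seq.hyps by (auto simp: incseq_def le_fun_def intro!: nn_integral_mono)
  have "2 * (SUP i. \<integral>\<^sup>+x. U i x \<partial>\<mu>) = (SUP i. 2 * (\<integral>\<^sup>+x. U i x \<partial>\<mu>))"
    by (simp add: SUP_mult_left_ennreal)
  also have "\<dots> = (SUP i. (\<integral>\<^sup>+x. U i x \<partial>branch 0) + (\<integral>\<^sup>+x. U i x \<partial>branch a))"
    by (simp add: seq.IH)
  also have "\<dots> = (SUP i. \<integral>\<^sup>+x. U i x \<partial>branch 0) + (SUP i. \<integral>\<^sup>+x. U i x \<partial>branch a)"
    by (rule ennreal_SUP_add[OF mono mono])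
  finally show ?case by (simp only: SUP sets_\<mu> sets_branch)
qed

lemma integral_invariant_real:
  fixes f :: "real \<Rightarrow> real"
  assumes [measurable]: "f \<in> borel_measurable borel" and f1: "\<And>x. \<bar>f x\<bar> \<le> 1"
  shows "2 * (LINT x|\<mu>. f x) = (LINT x|branch 0. f x) + (LINT x|branch a. f x)"
proof -
  have shifted: "(\<integral>\<^sup>+x. ennreal (1 + f x) \<partial>M) = ennreal (1 + (LINT x|M. f x))" "-1 \<le> (LINT x|M. f x)"
    if M: "prob_space M" "sets M = sets borel" for M
  proof -
    interpret M: prob_space M by (rule M(1))
    have [measurable]: "f \<in> borel_measurable M" using M(2) by (simp cong: measurable_cong_sets)
    have i: "integrable M f" by (rule M.integrable_const_bound[where B = 1]) (simp_all add: f1)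
    have pos: "0 \<le> 1 + f x" for x using f1[of x] by (simp add: abs_le_iff)
    have int: "(LINT x|M. 1 + f x) = 1 + (LINT x|M. f x)" using i M.prob_space by simp
    have "0 \<le> (LINT x|M. 1 + f x)" using pos by (intro integral_nonneg_AE) simp
    then show "-1 \<le> (LINT x|M. f x)" using int by simp
    show "(\<integral>\<^sup>+x. ennreal (1 + f x) \<partial>M) = ennreal (1 + (LINT x|M. f x))"
      unfolding int[symmetric] using i pos by (intro nn_integral_eq_integral) auto
  qed
  note s = shifted[OF prob_space_axioms sets_\<mu>] shifted[OF prob_space_branch sets_branch]
  have "2 * (\<integral>\<^sup>+x. ennreal (1 + f x) \<partial>\<mu>) =
      (\<integral>\<^sup>+x. ennreal (1 + f x) \<partial>branch 0) + (\<integral>\<^sup>+x. ennreal (1 + f x) \<partial>branch a)"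
    by (rule nn_integral_invariant) measurable
  then have "2 * ennreal (1 + (LINT x|\<mu>. f x)) =
      ennreal (1 + (LINT x|branch 0. f x)) + ennreal (1 + (LINT x|branch a. f x))"
    by (simp only: s)
  moreover have "0 \<le> 1 + (LINT x|\<mu>. f x)" "0 \<le> 1 + (LINT x|branch b. f x)" for b
    using s(2) s(4)[of b] by auto
  ultimately have "ennreal (2 * (1 + (LINT x|\<mu>. f x))) =
      ennreal ((1 + (LINT x|branch 0. f x)) + (1 + (LINT x|branch a. f x)))"
    by (simp only: ennreal_mult ennreal_plus) (simp add: ennreal_mult)
  moreover have "0 \<le> (1 + (LINT x|branch 0. f x)) + (1 + (LINT x|branch a. f x))"
    using s(4)[of 0] s(4)[of a] by simp
  moreover have "0 \<le> 2 * (1 + (LINT x|\<mu>. f x))" using s(2) by simp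
  ultimately have "2 * (1 + (LINT x|\<mu>. f x)) = (1 + (LINT x|branch 0. f x)) + (1 + (LINT x|branch a. f x))"
    by (simp only: ennreal_inj)
  then show ?thesis by (simp add: algebra_simps)
qed

lemma integral_invariant:
  fixes f :: "real \<Rightarrow> complex"
  assumes [measurable]: "f \<in> borel_measurable borel" and f1: "\<And>x. cmod (f x) \<le> 1"
  shows "2 * (LINT x|\<mu>. f x) = (LINT x|\<mu>. f (x / of_int R)) + (LINT x|\<mu>. f (x / of_int R + a))"
proof -
  have i: "integrable M f" if M: "prob_space M" "sets M = sets borel" for M
  proof -
    interpret M: prob_space M by (rule M(1))
    have "f \<in> borel_measurable M" using M(2) by (simp cong: measurable_cong_sets)
    then show ?thesis by (intro M.integrable_const_bound[where B = 1]) (simp_all add: f1)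
  qed
  note ints = i[OF prob_space_axioms sets_\<mu>] i[OF prob_space_branch sets_branch]
  have "2 * (LINT x|\<mu>. f x) = (LINT x|branch 0. f x) + (LINT x|branch a. f x)"
  proof (rule complex_eqI)
    show "Re (2 * (LINT x|\<mu>. f x)) = Re ((LINT x|branch 0. f x) + (LINT x|branch a. f x))"
      using integral_invariant_real[of "\<lambda>x. Re (f x)"] order_trans[OF abs_Re_le_cmod f1]
      by (simp add: ints)
    show "Im (2 * (LINT x|\<mu>. f x)) = Im ((LINT x|branch 0. f x) + (LINT x|branch a. f x))"
      using integral_invariant_real[of "\<lambda>x. Im (f x)"] order_trans[OF abs_Im_le_cmod f1]
      by (simp add: ints)
  qed
  moreover have "(LINT x|branch b. f x) = (LINT x|\<mu>. f (x / of_int R + b))" for b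
    unfolding branch_def by (subst integral_distr) (simp_all add: sigma_map_def divide_inverse mult.commute)
  ultimately show ?thesis by simp
qed

text \<open>The exponentials in the unit of frequency \<open>1 / (2 * a)\<close>, in which the zeros of the transform are
  integers whatever \<open>a\<close> is (for odd \<open>R\<close> exactly the odd ones).\<close>

definition freq :: "real \<Rightarrow> real \<Rightarrow> complex" where
  "freq u = e_fun (u / (2 * a))"

definition transform :: "real \<Rightarrow> complex" where
  "transform u = (LINT x|\<mu>. freq u x)"

definition transform_sq :: "real \<Rightarrow> real" where
  "transform_sq u = (cmod (transform u))\<^sup>2"

lemma freq_measurable [measurable]: "freq u \<in> borel_measurable borel"
  by (simp add: freq_def)

lemma cmod_freq [simp]: "cmod (freq u x) = 1"
  by (simp add: freq_def)

lemma freq_L2: "freq u \<in> L2_space \<mu>"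
  unfolding freq_def by (rule e_fun_L2) (simp_all add: finite_measure_axioms)

lemma transform_refine: "2 * transform u = (1 + cis (pi * u)) * transform (u / of_int R)"
proof -
  have 0: "freq u (x / of_int R) = freq (u / of_int R) x" for x
    by (simp add: freq_def e_fun_cis algebra_simps)
  have "freq u (x / of_int R + a) = cis (pi * u) * freq (u / of_int R) x" for x
  proof -
    have "2 * pi * (u / (2 * a)) * (x / of_int R + a) = pi * u + 2 * pi * (u / of_int R / (2 * a)) * x"
      using a_nonzero by (simp add: distrib_left)
    then show ?thesis by (simp only: freq_def e_fun_cis cis_mult)
  qed
  then have "2 * transform u = transform (u / of_int R) + cis (pi * u) * transform (u / of_int R)"
    unfolding transform_def
    by (subst integral_invariant) (simp_all add: 0)
  then show ?thesis by (simp add: algebra_simps)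
qed

sublocale cosine_product R transform_sq
proof
  show "\<bar>R\<bar> \<ge> 2" by (rule abs_R)
  show "transform_sq u \<ge> 0" for u by (simp add: transform_sq_def)
  show "transform_sq u \<le> 1" for u
  proof -
    have "cmod (transform u) \<le> (LINT x|\<mu>. cmod (freq u x))"
      unfolding transform_def by (rule integral_norm_bound)
    then have "cmod (transform u) \<le> 1" by simp
    then show ?thesis unfolding transform_sq_def by (simp add: power_le_one)
  qed
  show "transform_sq 0 = 1" by (simp add: transform_sq_def transform_def freq_def)
  show "continuous_on UNIV transform_sq"
  proof -
    interpret real_distribution \<mu>
      by unfold_locales simp_all
    have "transform u = char \<mu> (pi * u / a)" for u
      unfolding transform_def char_def freq_def e_fun_def by (simp add: mult_ac)
    moreover have "continuous_on UNIV (\<lambda>u. char \<mu> (pi * u / a))"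
    proof (rule continuous_on_compose2[of UNIV "char \<mu>"])
      show "continuous_on UNIV (char \<mu>)"
        by (intro continuous_at_imp_continuous_on ballI isCont_char)
    qed (use a_nonzero in \<open>auto intro!: continuous_intros\<close>)
    ultimately show ?thesis unfolding transform_sq_def by (auto intro!: continuous_intros)
  qed
  show "transform_sq u = (cos (pi * u / 2))\<^sup>2 * transform_sq (u / of_int R)" for u
  proof -
    have "4 * transform_sq u = (cmod (2 * transform u))\<^sup>2" by (simp add: transform_sq_def norm_mult power_mult_distrib)
    also have "\<dots> = (cmod (1 + cis (pi * u)))\<^sup>2 * transform_sq (u / of_int R)"
      unfolding transform_refine by (simp add: transform_sq_def norm_mult power_mult_distrib)
    finally show ?thesis by (simp add: cmod_1_plus_cis)
  qed
qed

lemma L2_inner_freq: "L2_inner \<mu> (freq u) (freq v) = transform (u - v)"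
  unfolding L2_inner_def transform_def freq_def e_fun_mult_cnj by (simp add: diff_divide_distrib)

lemma L2_inner_freq_eq_0_iff: "L2_inner \<mu> (freq u) (freq v) = 0 \<longleftrightarrow> transform_sq (u - v) = 0"
  by (simp add: L2_inner_freq transform_sq_def)

lemma freq_eq_iff [simp]: "freq u = freq v \<longleftrightarrow> u = v"
  using a_nonzero by (simp add: freq_def)

lemma dist_freq_combination:
  assumes "finite F" "F \<subseteq> freq ` U"
    and orth: "\<And>u v. u \<in> U \<Longrightarrow> v \<in> U \<Longrightarrow> u \<noteq> v \<Longrightarrow> transform_sq (u - v) = 0"
  shows "(LINT x|\<mu>. (cmod (freq t x - (\<Sum>g\<in>F. c g * g x)))\<^sup>2) =
    1 - (\<Sum>g\<in>F. (cmod (L2_inner \<mu> (freq t) g))\<^sup>2) + (\<Sum>g\<in>F. (cmod (c g - L2_inner \<mu> (freq t) g))\<^sup>2)"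
proof -
  have norm1: "(LINT x|\<mu>. (cmod (freq u x))\<^sup>2) = 1" for u
    by (simp add: freq_def)
  show ?thesis
  proof (subst L2_dist_orthonormal_combination[OF freq_L2 assms(1)])
    show "F \<subseteq> L2_space \<mu>" using assms(2) freq_L2 by auto
  next
    fix g assume "g \<in> F"
    then show "(LINT x|\<mu>. (cmod (g x))\<^sup>2) = 1" using assms(2) norm1 by blast
  next
    fix g h assume "g \<in> F" "h \<in> F" "g \<noteq> h"
    then obtain u v where "u \<in> U" "v \<in> U" "g = freq u" "h = freq v" "u \<noteq> v"
      using assms(2) by blast
    then show "L2_inner \<mu> g h = 0" using orth by (simp add: L2_inner_freq_eq_0_iff)
  qed (simp_all add: norm1)
qed

section \<open>Odd scaling\<close>

text \<open>For odd \<open>R\<close> orthogonal frequencies differ by odd integers. Of three frequencies, one difference is the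
  sum of the two others, hence even; so there are at most two of them. The form of the conclusion covers
  fewer than two as well.\<close>

lemma orthogonal_frequencies_odd:
  assumes "odd R" and orth: "\<And>u v. u \<in> U \<Longrightarrow> v \<in> U \<Longrightarrow> u \<noteq> v \<Longrightarrow> transform_sq (u - v) = 0"
  obtains u0 j where "odd (j :: int)" "U \<subseteq> {u0, u0 + of_int j}"
proof (cases "U = {}")
  case True
  then show ?thesis using that[of 1 0] by simp
next
  case False
  then obtain u0 where u0: "u0 \<in> U" by blast
  show ?thesis
  proof (cases "U = {u0}")
    case True
    then show ?thesis using that[of 1 u0] by simp
  next
    case False
    then obtain u1 where u1: "u1 \<in> U" "u1 \<noteq> u0" using u0 by blast
    then obtain j where j: "odd j" "u1 - u0 = of_int j"
      using G_zero_odd[OF assms(1) orth[OF u1(1) u0]] by auto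
    have "u = u0 \<or> u = u1" if u: "u \<in> U" for u
    proof (rule ccontr)
      assume "\<not> (u = u0 \<or> u = u1)"
      then have "transform_sq (u - u0) = 0" "transform_sq (u - u1) = 0" using orth u u0 u1(1) by auto
      then obtain k l where "odd k" "u - u0 = of_int k" "odd l" "u - u1 = of_int l"
        by (elim G_zero_odd[OF assms(1)])
      moreover from this j have "real_of_int k = of_int (l + j)" by simp
      then have "k = l + j" by (simp only: of_int_eq_iff)
      ultimately show False using j(1) by simp
    qed
    then show ?thesis using j that[of j u0] by (auto simp: algebra_simps)
  qed
qed

lemma exponentials_eq_freq: "e_fun ` \<Lambda> = freq ` ((\<lambda>l. 2 * a * l) ` \<Lambda>)"
  using a_nonzero by (simp add: freq_def image_image)

text \<open>The frequency \<open>t = u0 + j + 2\<close> witnesses incompleteness: its distance \<open>j + 2\<close> from \<open>u0\<close> is odd, so the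
  two are orthogonal, and its distance 2 from \<open>u0 + j\<close> gives a squared coefficient \<open>transform_sq 2 < 1\<close>.
  So its squared distance from the span is at least \<open>1 - transform_sq 2 > 0\<close>.\<close>

lemma no_orthogonal_basis_of_exponentials:
  assumes "odd R"
  shows "\<not> has_orthogonal_basis_of_exponentials \<mu>"
proof
  assume "has_orthogonal_basis_of_exponentials \<mu>"
  then obtain \<Lambda> where basis: "L2_orthogonal_basis \<mu> (e_fun ` \<Lambda>)"
    by (auto simp: has_orthogonal_basis_of_exponentials_def)
  define U where "U = (\<lambda>l. 2 * a * l) ` \<Lambda>"
  have basis: "L2_orthogonal_basis \<mu> (freq ` U)"
    using basis unfolding exponentials_eq_freq U_def .
  then have orth: "transform_sq (u - v) = 0" if "u \<in> U" "v \<in> U" "u \<noteq> v" for u v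
    using that unfolding L2_orthogonal_basis_def by (simp add: L2_inner_freq_eq_0_iff)
  then obtain u0 j where j: "odd (j :: int)" and U: "U \<subseteq> {u0, u0 + of_int j}"
    using orthogonal_frequencies_odd[OF assms] by blast
  define t where "t = u0 + of_int j + 2"
  have t0: "transform_sq (t - u0) = 0" using G_odd[of "j + 2"] j by (simp add: t_def)
  have "sqrt (1 - transform_sq 2) > 0" using G_2_less_1 by simp
  then obtain F c where F: "finite F" "F \<subseteq> freq ` U"
      "L2_norm \<mu> (\<lambda>x. freq t x - (\<Sum>g\<in>F. c g * g x)) < sqrt (1 - transform_sq 2)"
    using basis freq_L2[of t] unfolding L2_orthogonal_basis_def by meson
  have "(\<Sum>g\<in>F. (cmod (L2_inner \<mu> (freq t) g))\<^sup>2) \<le>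
      (\<Sum>g\<in>freq ` {u0, u0 + of_int j}. (cmod (L2_inner \<mu> (freq t) g))\<^sup>2)"
    using F(2) U by (intro sum_mono2) auto
  also have "\<dots> = transform_sq (t - u0) + transform_sq (t - (u0 + of_int j))"
  proof -
    have "j \<noteq> 0" using j by auto
    then show ?thesis by (simp add: L2_inner_freq transform_sq_def)
  qed
  also have "\<dots> = transform_sq 2" using t0 by (simp add: t_def)
  finally have "(\<Sum>g\<in>F. (cmod (L2_inner \<mu> (freq t) g))\<^sup>2) \<le> transform_sq 2" .
  moreover have "(\<Sum>g\<in>F. (cmod (c g - L2_inner \<mu> (freq t) g))\<^sup>2) \<ge> 0"
    by (simp add: sum_nonneg)
  ultimately have "1 - transform_sq 2 \<le> (LINT x|\<mu>. (cmod (freq t x - (\<Sum>g\<in>F. c g * g x)))\<^sup>2)"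
    by (subst dist_freq_combination[OF F(1,2) orth]) auto
  then have "sqrt (1 - transform_sq 2) \<le> L2_norm \<mu> (\<lambda>x. freq t x - (\<Sum>g\<in>F. c g * g x))"
    by (simp add: L2_norm_def)
  with F(3) show False by simp
qed

section \<open>Even scaling\<close>

text \<open>By \<open>spectral_sum_tendsto_1\<close> the projections of an exponential to the spans of the frequencies in
  \<open>digit_sums R n\<close> exhaust its norm, so the Pythagorean identity makes the error tend to 0, and the density
  of the exponentials does the rest.\<close>

lemma orthogonal_basis_of_exponentials:
  assumes "even R" "\<bar>R\<bar> \<ge> 4"
  shows "has_orthogonal_basis_of_exponentials \<mu>"
proof -
  interpret even_cosine_product R transform_sq
    using assms by unfold_locales
  define U where "U = real_of_int ` (\<Union>n. digit_sums R n)"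
  have orth: "transform_sq (u - v) = 0" if "u \<in> U" "v \<in> U" "u \<noteq> v" for u v
  proof -
    from that obtain m n \<gamma> \<delta> where "\<gamma> \<in> digit_sums R m" "\<delta> \<in> digit_sums R n" "u = of_int \<gamma>" "v = of_int \<delta>"
      by (auto simp: U_def)
    moreover have "\<gamma> \<in> digit_sums R (max m n)" "\<delta> \<in> digit_sums R (max m n)"
      using calculation digit_sums_mono[of m "max m n" R] digit_sums_mono[of n "max m n" R] by auto
    ultimately show ?thesis
      using G_digit_sums_diff[of \<gamma> "max m n" \<delta>] that(3) by simp
  qed
  have U_L2: "freq ` U \<subseteq> L2_space \<mu>" using freq_L2 by auto
  have freq_closure: "freq t \<in> L2_closure \<mu> (freq ` U)" for t
  proof (rule L2_closureI[OF freq_L2])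
    fix \<epsilon> :: real assume "\<epsilon> > 0"
    then have "\<forall>\<^sub>F n in sequentially. (\<Sum>\<gamma>\<in>digit_sums R n. transform_sq (t - of_int \<gamma>)) > 1 - \<epsilon>"
      using spectral_sum_tendsto_1[of t] by (intro order_tendstoD(1)) auto
    then obtain n where n: "(\<Sum>\<gamma>\<in>digit_sums R n. transform_sq (t - of_int \<gamma>)) > 1 - \<epsilon>"
      by (auto simp: eventually_sequentially)
    define F where "F = (\<lambda>\<gamma>. freq (of_int \<gamma>)) ` digit_sums R n"
    have F: "finite F" "F \<subseteq> freq ` U" by (auto simp: F_def U_def)
    have "(LINT x|\<mu>. (cmod (freq t x - (\<Sum>g\<in>F. L2_inner \<mu> (freq t) g * g x)))\<^sup>2) =
        1 - (\<Sum>g\<in>F. (cmod (L2_inner \<mu> (freq t) g))\<^sup>2)"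
      by (subst dist_freq_combination[OF F orth]) simp_all
    also have "(\<Sum>g\<in>F. (cmod (L2_inner \<mu> (freq t) g))\<^sup>2) = (\<Sum>\<gamma>\<in>digit_sums R n. transform_sq (t - of_int \<gamma>))"
      unfolding F_def by (subst sum.reindex) (auto intro!: inj_onI simp: L2_inner_freq transform_sq_def)
    finally show "\<exists>F c. finite F \<and> F \<subseteq> freq ` U \<and>
        (LINT x|\<mu>. (cmod (freq t x - (\<Sum>g\<in>F. c g * g x)))\<^sup>2) < \<epsilon>"
      using F n by (intro exI[of _ F] exI[of _ "\<lambda>g. L2_inner \<mu> (freq t) g"]) simp
  qed
  have "e_fun s \<in> L2_closure \<mu> (freq ` U)" for s
    using freq_closure[of "2 * a * s"] a_nonzero by (simp add: freq_def)
  then have closure: "L2_closure \<mu> (freq ` U) = L2_space \<mu>"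
    by (intro L2_closure_eq_L2_space finite_measure_axioms sets_\<mu> U_L2)
  have "L2_orthogonal_basis \<mu> (freq ` U)"
    unfolding L2_orthogonal_basis_def
  proof (intro conjI ballI impI allI)
    show "freq ` U \<subseteq> L2_space \<mu>" by (rule U_L2)
  next
    fix g assume "g \<in> freq ` U"
    then show "L2_norm \<mu> g \<noteq> 0" by (auto simp: L2_norm_def freq_def)
  next
    fix g h assume "g \<in> freq ` U" "h \<in> freq ` U" "g \<noteq> h"
    then show "L2_inner \<mu> g h = 0" using orth by (auto simp: L2_inner_freq_eq_0_iff)
  next
    fix f and \<epsilon> :: real assume f: "f \<in> L2_space \<mu>" and \<epsilon>: "0 < \<epsilon>"
    then have "f \<in> L2_closure \<mu> (freq ` U)" "0 < \<epsilon>\<^sup>2" by (simp_all add: closure)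
    then obtain F c where F: "finite F" "F \<subseteq> freq ` U"
        and lt: "(LINT x|\<mu>. (cmod (f x - (\<Sum>g\<in>F. c g * g x)))\<^sup>2) < \<epsilon>\<^sup>2"
      by (rule L2_closureE)
    have "L2_norm \<mu> (\<lambda>x. f x - (\<Sum>g\<in>F. c g * g x)) < \<epsilon>"
      using real_sqrt_less_mono[OF lt] \<epsilon> by (simp add: L2_norm_def)
    with F show "\<exists>F c. finite F \<and> F \<subseteq> freq ` U \<and>
        L2_norm \<mu> (\<lambda>x. f x - (\<Sum>g\<in>F. c g * g x)) < \<epsilon>" by blast
  qed
  then show ?thesis
    unfolding has_orthogonal_basis_of_exponentials_def
    by (intro exI[of _ "(\<lambda>u. u / (2 * a)) ` U"]) (simp add: freq_def[abs_def] image_image)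
qed

end

theorem theorem4p1:
  fixes R :: int
  assumes "\<bar>R\<bar> \<ge> 2"
  shows "(odd R \<longrightarrow>
            (\<forall>a :: real. a \<noteq> 0 \<longrightarrow> (\<forall>\<mu>. invariant_prob_measure R a \<mu> \<longrightarrow>
               \<not> has_orthogonal_basis_of_exponentials \<mu>))) \<and>
         (even R \<and> \<bar>R\<bar> \<ge> 4 \<longrightarrow>
            (\<forall>a :: real. a \<noteq> 0 \<longrightarrow> (\<forall>\<mu>. invariant_prob_measure R a \<mu> \<longrightarrow>
               has_orthogonal_basis_of_exponentials \<mu>)))"
proof -
  have "invariant_measure R a \<mu>" if "a \<noteq> 0" "invariant_prob_measure R a \<mu>" for a \<mu>
    using assms that by (rule invariant_measure.intro)
  then show ?thesis
    using invariant_measure.no_orthogonal_basis_of_exponentials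
      invariant_measure.orthogonal_basis_of_exponentials by blast
qed

end
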